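(* There is a randomized algorithm which takes as input parameters $k\in\mathbb{N}$ and $\epsilon>0$ and has query (oracle) access to an arbitrary function $f:\{-1,1\}^n\to\{-1,1\}$, makes $\mathrm{poly}(k,1/\epsilon)$ queries to $f$, and with probability at least $2/3$ outputs a number $\widehat{\mathsf{Corr}}_{f,\mathsf{gap},k}$ satisfying \[ \max_{g\in\mathcal{J}_{n,k}} \mathbf{E}_{\mathbf{x}}[g(\mathbf{x})f(\mathbf{x})] - \epsilon \le \widehat{\mathsf{Corr}}_{f,\mathsf{gap},k} \le \max_{g\in\mathcal{J}_{n,k^2/\epsilon^2}} \mathbf{E}_{\mathbf{x}}[g(\mathbf{x})f(\mathbf{x})] + \epsilon. \]
   Context: A function $g:\{-1,1\}^n\to\{-1,1\}$ is a $k$-junta if there is a set of at most $k$ coordinates such that $g(x)$ depends only on the values of $x$ on those coordinates. $\mathcal{J}_{n,m}$ denotes the class of $m$-juntas on $n$ variables (for non-integer $m$, juntas on at most $m$ coordinates). All expectations are over $\mathbf{x}$ uniform on $\{-1,1\}^n$. Query complexity is the number of evaluations of $f$. *)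

theory Defs
  imports "HOL-Probability.Probability"
begin

definition cube :: "nat \<Rightarrow> (nat \<Rightarrow> real) set" where
  "cube n = {..<n} \<rightarrow>\<^sub>E {-1, 1}"

definition boolean_functions :: "nat \<Rightarrow> ((nat \<Rightarrow> real) \<Rightarrow> real) set" where
  "boolean_functions n = cube n \<rightarrow>\<^sub>E {-1, 1}"

text \<open>The size bound \<open>m\<close> is real, so that non-integral bounds make sense.\<close>

definition juntas :: "nat \<Rightarrow> real \<Rightarrow> ((nat \<Rightarrow> real) \<Rightarrow> real) set" where
  "juntas n m = {g \<in> boolean_functions n.
     \<exists>J \<subseteq> {..<n}. real (card J) \<le> m \<and>
       (\<forall>x \<in> cube n. \<forall>y \<in> cube n. (\<forall>i \<in> J. x i = y i) \<longrightarrow> g x = g y)}"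

definition correlation ::
  "nat \<Rightarrow> ((nat \<Rightarrow> real) \<Rightarrow> real) \<Rightarrow> ((nat \<Rightarrow> real) \<Rightarrow> real) \<Rightarrow> real" where
  "correlation n g f = measure_pmf.expectation (pmf_of_set (cube n)) (\<lambda>x. g x * f x)"

definition max_junta_correlation :: "nat \<Rightarrow> real \<Rightarrow> ((nat \<Rightarrow> real) \<Rightarrow> real) \<Rightarrow> real" where
  "max_junta_correlation n m f = Max ((\<lambda>g. correlation n g f) ` juntas n m)"

text \<open>
  A deterministic adaptive query algorithm: it either stops with an output or queries a point and
  continues depending on the oracle's answer. A randomized query algorithm is a probability
  distribution over deterministic ones (all coins are tossed in advance).
\<close>

datatype query_alg =
    Output real
  | Query "nat \<Rightarrow> real" "real \<Rightarrow> query_alg"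

type_synonym rand_query_alg = "query_alg pmf"

primrec run :: "((nat \<Rightarrow> real) \<Rightarrow> real) \<Rightarrow> query_alg \<Rightarrow> real" where
  "run f (Output r) = r"
| "run f (Query x next_step) = run f (next_step (f x))"

primrec queries :: "((nat \<Rightarrow> real) \<Rightarrow> real) \<Rightarrow> query_alg \<Rightarrow> (nat \<Rightarrow> real) list" where
  "queries f (Output r) = []"
| "queries f (Query x next_step) = x # queries f (next_step (f x))"

end

theory Submission
  imports Defs
begin

text \<open>
  For a set \<open>J\<close> of coordinates let \<open>f\<^sub>J\<close> be the average of \<open>f\<close> over the coordinates outside \<open>J\<close>.
  The best correlation of \<open>f\<close> with a function of the coordinates in \<open>J\<close> is \<open>E \<bar>f\<^sub>J\<bar>\<close>, and passing
  from \<open>J\<close> to a subset \<open>L\<close> costs at most the square root of the Fourier weight of \<open>f\<close> on the sets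
  contained in \<open>J\<close> but not in \<open>L\<close>.

  Damp the Fourier weight of \<open>U\<close> by \<open>\<gamma> ^ card U\<close> with \<open>\<gamma> = k / (k + 1)\<close>. Since
  \<open>l * \<gamma> ^ l \<le> k * \<gamma> ^ k\<close> for every \<open>l\<close>, the damped influences of the coordinates sum to at most
  \<open>k * \<gamma> ^ k\<close>, so at most \<open>k\<^sup>2 / \<epsilon>\<^sup>2\<close> coordinates are heavy, i.e. have damped influence at least
  \<open>\<gamma> ^ k * \<epsilon>\<^sup>2 / k\<close>. Dropping the light coordinates of a set of size \<open>k\<close> is cheap, because damping
  costs at most the factor \<open>\<gamma> ^ k\<close> on sets of size at most \<open>k\<close>.

  The heavy coordinates cannot be located with a number of queries independent of \<open>n\<close>, but they need
  not be: hash the coordinates into polynomially many buckets, estimate the damped influence of every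
  bucket and let \<open>R\<close> be the union of the influential ones. With high probability an influential
  bucket contains a heavy coordinate, for otherwise two light coordinates of substantial influence
  would collide. A set that is not made of heavy coordinates only is unlikely to fall into the buckets
  of the heavy ones, so \<open>E \<bar>f\<^sub>R\<bar>\<close>, which can be estimated by sampling, is close to the value for
  the heavy coordinates. The two-sided slack \<open>\<epsilon>\<close> absorbs all estimation errors.
\<close>

subsection \<open>Fourier analysis on the cube\<close>

lemma finite_cube: "finite (cube n)"
  unfolding cube_def by (intro finite_PiE) auto

lemma card_cube: "card (cube n) = 2 ^ n"
  unfolding cube_def by (simp add: card_PiE numeral_2_eq_2)

lemma cube_nonempty: "cube n \<noteq> {}"
  unfolding cube_def by (simp add: PiE_eq_empty_iff)

lemma set_pmf_cube: "set_pmf (pmf_of_set (cube n)) = cube n"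
  by (simp add: finite_cube cube_nonempty)

lemma cube_mult_self: "x \<in> cube n \<Longrightarrow> i < n \<Longrightarrow> x i * x i = 1"
  unfolding cube_def by (auto dest!: PiE_mem[where x = i])

definition glue :: "'a set \<Rightarrow> ('a \<Rightarrow> 'b) \<Rightarrow> ('a \<Rightarrow> 'b) \<Rightarrow> 'a \<Rightarrow> 'b" where
  "glue J x y = (\<lambda>i. if i \<in> J then x i else y i)"

lemma glue_in_cube: "x \<in> cube n \<Longrightarrow> y \<in> cube n \<Longrightarrow> glue J x y \<in> cube n"
  unfolding cube_def glue_def by (auto simp: PiE_iff extensional_def)

lemma boolean_function_abs: "f \<in> boolean_functions n \<Longrightarrow> x \<in> cube n \<Longrightarrow> \<bar>f x\<bar> = 1"
  unfolding boolean_functions_def by (drule (1) PiE_mem) auto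

section \<open>Averages over the uniform cube\<close>

definition avg :: "nat \<Rightarrow> ((nat \<Rightarrow> real) \<Rightarrow> real) \<Rightarrow> real" where
  "avg n F = measure_pmf.expectation (pmf_of_set (cube n)) F"

lemma avg_eq_sum: "avg n F = (\<Sum>x\<in>cube n. F x) / 2 ^ n"
  unfolding avg_def
  by (simp add: integral_pmf_of_set finite_cube cube_nonempty card_cube)

lemma avg_cong: "(\<And>x. x \<in> cube n \<Longrightarrow> F x = G x) \<Longrightarrow> avg n F = avg n G"
  by (simp add: avg_eq_sum)

lemma avg_mono: "(\<And>x. x \<in> cube n \<Longrightarrow> F x \<le> G x) \<Longrightarrow> avg n F \<le> avg n G"
  by (simp add: avg_eq_sum divide_right_mono sum_mono)

lemma avg_const [simp]: "avg n (\<lambda>x. c) = c"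
  by (simp add: avg_def)

lemma avg_add: "avg n (\<lambda>x. F x + G x) = avg n F + avg n G"
  by (simp add: avg_eq_sum sum.distrib add_divide_distrib)

lemma avg_diff: "avg n (\<lambda>x. F x - G x) = avg n F - avg n G"
  by (simp add: avg_eq_sum sum_subtractf diff_divide_distrib)

lemma avg_cmult: "avg n (\<lambda>x. c * F x) = c * avg n F"
  by (simp add: avg_eq_sum sum_distrib_left)

lemma avg_multc: "avg n (\<lambda>x. F x * c) = avg n F * c"
  using avg_cmult[of n c F] by (simp add: mult.commute)

lemma avg_sum: "avg n (\<lambda>x. \<Sum>i\<in>I. F i x) = (\<Sum>i\<in>I. avg n (F i))"
  unfolding avg_eq_sum sum_divide_distrib by (rule sum.swap)

lemma abs_avg_le: "\<bar>avg n F\<bar> \<le> avg n (\<lambda>x. \<bar>F x\<bar>)"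
  by (simp add: avg_eq_sum divide_right_mono)

lemma avg_square_le: "(avg n F)\<^sup>2 \<le> avg n (\<lambda>x. (F x)\<^sup>2)"
proof -
  have "0 \<le> avg n (\<lambda>x. (F x - avg n F)\<^sup>2)"
    using avg_mono[of n "\<lambda>_. 0" "\<lambda>x. (F x - avg n F)\<^sup>2"] by simp
  also have "avg n (\<lambda>x. (F x - avg n F)\<^sup>2)
      = avg n (\<lambda>x. ((F x)\<^sup>2 - (2 * avg n F) * F x) + (avg n F)\<^sup>2)"
    by (intro avg_cong) (simp add: power2_eq_square algebra_simps)
  also have "\<dots> = avg n (\<lambda>x. (F x)\<^sup>2) - (avg n F)\<^sup>2"
    by (simp add: avg_add avg_diff avg_cmult power2_eq_square)
  finally show ?thesis by simp
qed

lemma avg_abs_le_sqrt: "avg n (\<lambda>x. \<bar>F x\<bar>) \<le> sqrt (avg n (\<lambda>x. (F x)\<^sup>2))"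
  using avg_square_le[of n "\<lambda>x. \<bar>F x\<bar>"] by (intro real_le_rsqrt) simp

text \<open>The map \<open>(x, y) \<mapsto> (glue J x y, glue J y x)\<close> is an involution of the square of the cube.\<close>

lemma avg_glue: "avg n (\<lambda>x. avg n (\<lambda>y. F (glue J x y))) = avg n F"
proof -
  have "(\<Sum>x\<in>cube n. \<Sum>y\<in>cube n. F (glue J x y)) = (\<Sum>(x, y)\<in>cube n \<times> cube n. F (glue J x y))"
    by (simp add: sum.cartesian_product)
  also have "\<dots> = (\<Sum>(x, y)\<in>cube n \<times> cube n. F x)"
    by (rule sum.reindex_bij_witness[where i = "\<lambda>(x, y). (glue J x y, glue J y x)"
          and j = "\<lambda>(x, y). (glue J x y, glue J y x)"])
       (auto simp: glue_in_cube, auto simp: glue_def fun_eq_iff)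
  also have "\<dots> = 2 ^ n * (\<Sum>x\<in>cube n. F x)"
    by (simp add: sum.cartesian_product[symmetric] card_cube sum_distrib_left)
  finally show ?thesis
    by (simp add: avg_eq_sum sum_divide_distrib[symmetric])
qed

section \<open>Characters, Parseval and Fourier inversion\<close>

definition character :: "nat set \<Rightarrow> (nat \<Rightarrow> real) \<Rightarrow> real" where
  "character U x = (\<Prod>i\<in>U. x i)"

text \<open>Writing a character as a product over all coordinates lets sums over the cube factor and
  products of characters be computed coordinatewise.\<close>

lemma character_restrict:
  assumes "U \<subseteq> {..<n}"
  shows "character U x = (\<Prod>i<n. if i \<in> U then x i else 1)"
  unfolding character_def using assms
  by (simp add: prod.If_cases Int_absorb1)

lemma avg_character:
  assumes "U \<subseteq> {..<n}"
  shows "avg n (character U) = (if U = {} then 1 else 0)"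
proof (cases "U = {}")
  case True
  then show ?thesis by (simp add: character_def[abs_def])
next
  case False
  have "(\<Sum>x\<in>cube n. character U x) = (\<Sum>x\<in>cube n. \<Prod>i<n. if i \<in> U then x i else 1)"
    by (simp add: character_restrict[OF assms])
  \<comment> \<open>The cube is a product set, so the sum factors; a coordinate in \<open>U\<close>
    contributes \<open>-1 + 1 = 0\<close>.\<close>
  also have "\<dots> = (\<Prod>i<n. \<Sum>v\<in>{-1, 1::real}. if i \<in> U then v else 1)"
    unfolding cube_def by (rule prod_sum_PiE[symmetric]) auto
  also have "\<dots> = 0"
  proof (rule prod_zero)
    show "\<exists>i\<in>{..<n}. (\<Sum>v\<in>{-1, 1::real}. if i \<in> U then v else 1) = 0"
      using False assms by fastforce
  qed simp
  finally show ?thesis using False by (simp add: avg_eq_sum)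
qed

text \<open>Coordinates common to \<open>U\<close> and \<open>V\<close> contribute a square, which
  is 1 on the cube, so only the symmetric difference survives.\<close>

lemma character_mult:
  assumes "x \<in> cube n" "U \<subseteq> {..<n}" "V \<subseteq> {..<n}"
  shows "character U x * character V x = character ((U - V) \<union> (V - U)) x"
proof -
  have "character U x * character V x
      = (\<Prod>i<n. (if i \<in> U then x i else 1) * (if i \<in> V then x i else 1))"
    by (simp add: character_restrict[OF assms(2)] character_restrict[OF assms(3)] prod.distrib)
  also have "\<dots> = (\<Prod>i<n. if i \<in> (U - V) \<union> (V - U) then x i else 1)"
    by (intro prod.cong) (use cube_mult_self[OF assms(1)] in auto)
  also have "\<dots> = character ((U - V) \<union> (V - U)) x"
    by (rule character_restrict[symmetric]) (use assms in auto)
  finally show ?thesis .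
qed

lemma avg_character_mult:
  assumes "U \<subseteq> {..<n}" "V \<subseteq> {..<n}"
  shows "avg n (\<lambda>x. character U x * character V x) = (if U = V then 1 else 0)"
proof -
  have "avg n (\<lambda>x. character U x * character V x) = avg n (character ((U - V) \<union> (V - U)))"
    by (intro avg_cong) (rule character_mult[OF _ assms])
  also have "\<dots> = (if U = V then 1 else 0)"
    using assms by (subst avg_character) auto
  finally show ?thesis .
qed

text \<open>Parseval. The family \<open>F\<close> is left free because it is applied to all subsets
  of \<open>{..<n}\<close>, to \<open>Pow J\<close> and to \<open>Pow J - Pow L\<close>.\<close>

lemma avg_square_character_sum:
  assumes "F \<subseteq> Pow {..<n}"
  shows "avg n (\<lambda>x. (\<Sum>U\<in>F. c U * character U x)\<^sup>2) = (\<Sum>U\<in>F. (c U)\<^sup>2)"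
proof -
  have "finite F" using assms by (rule finite_subset) simp
  have "avg n (\<lambda>x. (\<Sum>U\<in>F. c U * character U x)\<^sup>2)
      = avg n (\<lambda>x. \<Sum>U\<in>F. \<Sum>V\<in>F. (c U * c V) * (character U x * character V x))"
    by (intro avg_cong) (simp add: power2_eq_square sum_product mult_ac)
  also have "\<dots> = (\<Sum>U\<in>F. \<Sum>V\<in>F. (c U * c V) * (if U = V then 1 else 0))"
    unfolding avg_sum avg_cmult
    by (intro sum.cong refl arg_cong2[where f = "(*)"] avg_character_mult) (use assms in auto)
  also have "\<dots> = (\<Sum>U\<in>F. (c U)\<^sup>2)"
    using \<open>finite F\<close> by (simp add: power2_eq_square if_distrib[of "(*) _"] cong: if_cong)
  finally show ?thesis .
qed

definition fourier :: "nat \<Rightarrow> ((nat \<Rightarrow> real) \<Rightarrow> real) \<Rightarrow> nat set \<Rightarrow> real" where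
  "fourier n f U = avg n (\<lambda>x. f x * character U x)"

text \<open>The sum is the expansion of a product of factors \<open>x i * y i + 1\<close>, one of
  which vanishes as soon as the points differ. This dual orthogonality gives Fourier
  inversion.\<close>

lemma sum_character_mult:
  assumes "x \<in> cube n" "y \<in> cube n"
  shows "(\<Sum>U\<in>Pow {..<n}. character U x * character U y) = (if x = y then 2 ^ n else 0)"
proof -
  have "(\<Sum>U\<in>Pow {..<n}. character U x * character U y) = (\<Prod>i<n. x i * y i + 1)"
    by (subst prod_add) (auto simp: character_def prod.distrib)
  also have "\<dots> = (if x = y then 2 ^ n else 0)"
  proof (cases "x = y")
    case True
    then show ?thesis using cube_mult_self[OF assms(2)] by simp
  next
    case False
    then obtain i where i: "i < n" "x i \<noteq> y i"
      using assms unfolding cube_def by (metis PiE_ext lessThan_iff)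
    then have "x i * y i + 1 = 0"
      using assms unfolding cube_def by (auto dest!: PiE_mem[where x = i])
    with i have "(\<Prod>i<n. x i * y i + 1) = 0"
      by (intro prod_zero) auto
    then show ?thesis using False by simp
  qed
  finally show ?thesis .
qed

lemma fourier_expansion:
  assumes "x \<in> cube n"
  shows "f x = (\<Sum>U\<in>Pow {..<n}. fourier n f U * character U x)"
proof -
  have "(\<Sum>U\<in>Pow {..<n}. fourier n f U * character U x)
      = avg n (\<lambda>y. f y * (\<Sum>U\<in>Pow {..<n}. character U y * character U x))"
    unfolding fourier_def avg_multc[symmetric] avg_sum[symmetric]
    by (simp add: sum_distrib_left mult_ac)
  also have "\<dots> = avg n (\<lambda>y. f y * (if y = x then 2 ^ n else 0))"
    by (intro avg_cong) (simp add: sum_character_mult assms)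
  also have "\<dots> = f x"
    using assms finite_cube by (simp add: avg_eq_sum if_distrib cong: if_cong)
  finally show ?thesis by simp
qed

section \<open>Averaging out the coordinates outside a set\<close>

definition cond_avg :: "nat \<Rightarrow> ((nat \<Rightarrow> real) \<Rightarrow> real) \<Rightarrow> nat set \<Rightarrow> (nat \<Rightarrow> real) \<Rightarrow> real" where
  "cond_avg n f J x = avg n (\<lambda>y. f (glue J x y))"

text \<open>Averaging over \<open>y\<close> kills every character with a coordinate outside
  \<open>J\<close> and leaves the others unchanged.\<close>

lemma cond_avg_expansion:
  assumes "x \<in> cube n" "J \<subseteq> {..<n}"
  shows "cond_avg n f J x = (\<Sum>U\<in>Pow J. fourier n f U * character U x)"
proof -
  have character_glue: "character U (glue J x y) = character (U \<inter> J) x * character (U - J) y"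
    if "U \<subseteq> {..<n}" for U y
  proof -
    have "finite U" using that finite_subset by blast
    then show ?thesis
      unfolding character_def glue_def
      by (simp add: prod.If_cases Diff_eq)
  qed
  have "cond_avg n f J x
      = avg n (\<lambda>y. \<Sum>U\<in>Pow {..<n}. fourier n f U * character U (glue J x y))"
    unfolding cond_avg_def
    by (intro avg_cong fourier_expansion glue_in_cube assms)
  also have "\<dots> = avg n (\<lambda>y. \<Sum>U\<in>Pow {..<n}.
      (fourier n f U * character (U \<inter> J) x) * character (U - J) y)"
    by (intro avg_cong sum.cong refl) (simp add: character_glue)
  also have "\<dots> = (\<Sum>U\<in>Pow {..<n}.
      (fourier n f U * character (U \<inter> J) x) * (if U - J = {} then 1 else 0))"
    unfolding avg_sum avg_cmult
    by (intro sum.cong refl arg_cong2[where f = "(*)"] avg_character) auto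
  also have "\<dots> = (\<Sum>U\<in>Pow J. fourier n f U * character U x)"
    by (rule sum.mono_neutral_cong_right) (use assms in \<open>auto simp: Int_absorb2\<close>)
  finally show ?thesis .
qed

definition weight :: "nat \<Rightarrow> ((nat \<Rightarrow> real) \<Rightarrow> real) \<Rightarrow> nat set \<Rightarrow> real" where
  "weight n f J = (\<Sum>U\<in>Pow J. (fourier n f U)\<^sup>2)"

lemma avg_cond_avg_square:
  assumes "J \<subseteq> {..<n}"
  shows "avg n (\<lambda>x. (cond_avg n f J x)\<^sup>2) = weight n f J"
proof -
  have "avg n (\<lambda>x. (cond_avg n f J x)\<^sup>2)
      = avg n (\<lambda>x. (\<Sum>U\<in>Pow J. fourier n f U * character U x)\<^sup>2)"
    by (intro avg_cong) (simp add: cond_avg_expansion assms)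
  also have "\<dots> = weight n f J"
    unfolding weight_def by (rule avg_square_character_sum) (use assms in auto)
  finally show ?thesis .
qed

lemma sum_fourier_square:
  assumes "f \<in> boolean_functions n"
  shows "(\<Sum>U\<in>Pow {..<n}. (fourier n f U)\<^sup>2) = 1"
proof -
  have "(\<Sum>U\<in>Pow {..<n}. (fourier n f U)\<^sup>2)
      = avg n (\<lambda>x. (\<Sum>U\<in>Pow {..<n}. fourier n f U * character U x)\<^sup>2)"
    by (rule avg_square_character_sum[symmetric]) simp
  also have "\<dots> = avg n (\<lambda>x. 1)"
  proof (rule avg_cong)
    fix x assume x: "x \<in> cube n"
    then have "f x \<in> {-1, 1}" using assms unfolding boolean_functions_def by auto
    then show "(\<Sum>U\<in>Pow {..<n}. fourier n f U * character U x)\<^sup>2 = 1"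
      by (auto simp: fourier_expansion[OF x, symmetric])
  qed
  finally show ?thesis by simp
qed

section \<open>The L1 norm of the averaged function and correlation with juntas\<close>

definition cond_l1 :: "nat \<Rightarrow> ((nat \<Rightarrow> real) \<Rightarrow> real) \<Rightarrow> nat set \<Rightarrow> real" where
  "cond_l1 n f J = avg n (\<lambda>x. \<bar>cond_avg n f J x\<bar>)"

text \<open>The difference of L1 norms is at most the L1 norm of the difference, hence at most its
  L2 norm, which Parseval turns into Fourier weight.\<close>

lemma cond_l1_diff_le:
  assumes "L \<subseteq> J" "J \<subseteq> {..<n}"
  shows "cond_l1 n f J \<le> cond_l1 n f L + sqrt (\<Sum>U\<in>Pow J - Pow L. (fourier n f U)\<^sup>2)"
proof -
  have fin: "finite (Pow J)" using assms(2) finite_subset by auto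
  have "cond_l1 n f J - cond_l1 n f L \<le> avg n (\<lambda>x. \<bar>cond_avg n f J x - cond_avg n f L x\<bar>)"
    unfolding cond_l1_def avg_diff[symmetric] by (intro avg_mono) auto
  also have "\<dots> \<le> sqrt (avg n (\<lambda>x. (cond_avg n f J x - cond_avg n f L x)\<^sup>2))"
    by (rule avg_abs_le_sqrt)
  also have "avg n (\<lambda>x. (cond_avg n f J x - cond_avg n f L x)\<^sup>2)
      = avg n (\<lambda>x. (\<Sum>U\<in>Pow J - Pow L. fourier n f U * character U x)\<^sup>2)"
  proof (rule avg_cong)
    fix x assume "x \<in> cube n"
    moreover have "Pow L \<subseteq> Pow J" using assms(1) by auto
    ultimately show "(cond_avg n f J x - cond_avg n f L x)\<^sup>2
        = (\<Sum>U\<in>Pow J - Pow L. fourier n f U * character U x)\<^sup>2"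
      using assms by (simp add: cond_avg_expansion sum_diff[OF fin])
  qed
  also have "\<dots> = (\<Sum>U\<in>Pow J - Pow L. (fourier n f U)\<^sup>2)"
    by (rule avg_square_character_sum) (use assms in auto)
  finally show ?thesis by simp
qed

definition depends_on :: "nat \<Rightarrow> nat set \<Rightarrow> ((nat \<Rightarrow> real) \<Rightarrow> real) \<Rightarrow> bool" where
  "depends_on n J g \<longleftrightarrow> (\<forall>x \<in> cube n. \<forall>y \<in> cube n. (\<forall>i \<in> J. x i = y i) \<longrightarrow> g x = g y)"

text \<open>Resampling the coordinates outside \<open>J\<close> does not change \<open>g\<close>, so
  \<open>g\<close> comes out of the inner average.\<close>

lemma correlation_cond_avg:
  assumes "depends_on n J g"
  shows "correlation n g f = avg n (\<lambda>x. g x * cond_avg n f J x)"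
proof -
  have "correlation n g f = avg n (\<lambda>x. avg n (\<lambda>y. g (glue J x y) * f (glue J x y)))"
    unfolding correlation_def avg_def[symmetric] by (rule avg_glue[symmetric])
  also have "\<dots> = avg n (\<lambda>x. avg n (\<lambda>y. g x * f (glue J x y)))"
  proof (intro avg_cong)
    fix x y assume xy: "x \<in> cube n" "y \<in> cube n"
    have "\<forall>i\<in>J. glue J x y i = x i" by (simp add: glue_def)
    then have "g (glue J x y) = g x"
      using assms glue_in_cube[OF xy] xy(1) unfolding depends_on_def by blast
    then show "g (glue J x y) * f (glue J x y) = g x * f (glue J x y)" by simp
  qed
  finally show ?thesis by (simp add: avg_cmult cond_avg_def)
qed

lemma correlation_le_cond_l1:
  assumes "depends_on n J g" "g \<in> boolean_functions n"
  shows "correlation n g f \<le> cond_l1 n f J"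
  unfolding correlation_cond_avg[OF assms(1)] cond_l1_def
proof (rule avg_mono)
  fix x assume "x \<in> cube n"
  then have "g x \<in> {-1, 1}" using assms(2) unfolding boolean_functions_def by auto
  then show "g x * cond_avg n f J x \<le> \<bar>cond_avg n f J x\<bar>" by auto
qed

lemma correlation_eq_cond_l1:
  obtains g where "g \<in> boolean_functions n" "depends_on n J g" "correlation n g f = cond_l1 n f J"
proof
  \<comment> \<open>The sign of the averaged function is the optimal choice; \<open>restrict\<close>
    makes it extensional, as \<open>boolean_functions n\<close> demands.\<close>
  define g where "g = restrict (\<lambda>x. if cond_avg n f J x \<ge> 0 then 1 else -1 :: real) (cube n)"
  show "g \<in> boolean_functions n"
    unfolding boolean_functions_def g_def by auto
  have "glue J x z = glue J y z" if "\<forall>i\<in>J. x i = y i" for x y z :: "nat \<Rightarrow> real"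
    using that by (auto simp: glue_def)
  then have "cond_avg n f J x = cond_avg n f J y" if "\<forall>i\<in>J. x i = y i" for x y
    unfolding cond_avg_def using that by (intro avg_cong arg_cong[where f = f]) auto
  then show dep: "depends_on n J g"
    unfolding depends_on_def g_def by (metis (no_types, lifting) restrict_apply')
  show "correlation n g f = cond_l1 n f J"
    unfolding correlation_cond_avg[OF dep] cond_l1_def
    by (intro avg_cong) (auto simp: g_def)
qed

text \<open>The optimal function for \<open>L\<close> is also a candidate for
  \<open>J\<close>.\<close>

lemma cond_l1_mono:
  assumes "L \<subseteq> J"
  shows "cond_l1 n f L \<le> cond_l1 n f J"
proof -
  obtain g where g: "g \<in> boolean_functions n" "depends_on n L g" "correlation n g f = cond_l1 n f L"
    by (rule correlation_eq_cond_l1)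
  have "depends_on n J g" using g(2) assms unfolding depends_on_def by blast
  then show ?thesis using correlation_le_cond_l1 g by metis
qed

lemma juntas_alt: "juntas n m = {g \<in> boolean_functions n.
    \<exists>J \<subseteq> {..<n}. real (card J) \<le> m \<and> depends_on n J g}"
  unfolding juntas_def depends_on_def ..

lemma finite_juntas: "finite (juntas n m)"
proof (rule finite_subset)
  show "finite (boolean_functions n)"
    unfolding boolean_functions_def by (intro finite_PiE finite_cube) auto
qed (auto simp: juntas_alt)

lemma cond_l1_le_max_junta_correlation:
  assumes "J \<subseteq> {..<n}" "real (card J) \<le> m"
  shows "cond_l1 n f J \<le> max_junta_correlation n m f"
proof -
  obtain g where "g \<in> boolean_functions n" "depends_on n J g" "correlation n g f = cond_l1 n f J"
    by (rule correlation_eq_cond_l1)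
  then show ?thesis
    unfolding max_junta_correlation_def
    by (intro Max_ge) (use assms finite_juntas in \<open>auto simp: juntas_alt intro!: rev_image_eqI\<close>)
qed

lemma max_junta_correlation_le_cond_l1:
  assumes "0 \<le> m"
  obtains J where "J \<subseteq> {..<n}" "real (card J) \<le> m" "max_junta_correlation n m f \<le> cond_l1 n f J"
proof -
  obtain g where "g \<in> boolean_functions n" "depends_on n {} g"
    by (rule correlation_eq_cond_l1)
  \<comment> \<open>A function of no coordinates is a junta for every nonnegative \<open>m\<close>,
    so the maximum is over a nonempty set and is attained.\<close>
  then have "g \<in> juntas n m" using assms by (auto simp: juntas_alt intro!: exI[of _ "{}"])
  then have "juntas n m \<noteq> {}" by auto
  then have "max_junta_correlation n m f \<in> (\<lambda>g. correlation n g f) ` juntas n m"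
    unfolding max_junta_correlation_def using finite_juntas by (intro Max_in) auto
  then show ?thesis using that correlation_le_cond_l1 by (auto simp: juntas_alt)
qed

lemma cond_l1_le_1:
  assumes "f \<in> boolean_functions n"
  shows "cond_l1 n f J \<le> 1"
proof -
  have "\<bar>cond_avg n f J x\<bar> \<le> 1" if "x \<in> cube n" for x
  proof -
    have "\<bar>f (glue J x y)\<bar> \<le> 1" if "y \<in> cube n" for y
      using boolean_function_abs[OF assms glue_in_cube[OF \<open>x \<in> cube n\<close> that]] by simp
    then show ?thesis
      unfolding cond_avg_def
      using order_trans[OF abs_avg_le avg_mono[where G = "\<lambda>_. 1"]] by simp
  qed
  then show ?thesis
    unfolding cond_l1_def using avg_mono[where G = "\<lambda>_. 1"] by simp
qed

subsection \<open>Sampling\<close>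

lemma expectation_bind_pmf_finite:
  fixes F :: "'b \<Rightarrow> real"
  assumes "finite (set_pmf p)" "\<And>x. x \<in> set_pmf p \<Longrightarrow> finite (set_pmf (q x))"
  shows "measure_pmf.expectation (p \<bind> q) F
    = measure_pmf.expectation p (\<lambda>x. measure_pmf.expectation (q x) F)"
  using assms
  by (subst pmf_expectation_bind[of "set_pmf p"]) (auto simp: integral_measure_pmf[of "set_pmf p"])

lemma expectation_pair_pmf_finite:
  fixes F :: "'a \<times> 'b \<Rightarrow> real"
  assumes "finite (set_pmf p)" "finite (set_pmf q)"
  shows "measure_pmf.expectation (pair_pmf p q) F
    = measure_pmf.expectation p (\<lambda>x. measure_pmf.expectation q (\<lambda>y. F (x, y)))"
  using assms unfolding pair_pmf_def by (simp add: expectation_bind_pmf_finite)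

lemma expectation_mono_pmf_finite:
  fixes F G :: "'a \<Rightarrow> real"
  assumes "finite (set_pmf p)" "\<And>x. x \<in> set_pmf p \<Longrightarrow> F x \<le> G x"
  shows "measure_pmf.expectation p F \<le> measure_pmf.expectation p G"
  using assms by (intro integral_mono_AE integrable_measure_pmf_finite AE_pmfI)

lemma expectation_sum_pmf_finite:
  fixes F :: "'i \<Rightarrow> 'a \<Rightarrow> real"
  assumes "finite (set_pmf p)"
  shows "measure_pmf.expectation p (\<lambda>x. \<Sum>i\<in>I. F i x) = (\<Sum>i\<in>I. measure_pmf.expectation p (F i))"
  using assms by (intro Bochner_Integration.integral_sum integrable_measure_pmf_finite)

lemma expectation_of_bool: 
  "measure_pmf.expectation p (\<lambda>x. of_bool (P x)) = measure_pmf.prob p {x. P x}"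
proof -
  have "(\<lambda>x. of_bool (P x) :: real) = indicator {x. P x}"
    by (auto simp: indicator_def)
  then show ?thesis by simp
qed

lemma markov_pmf_finite:
  fixes u :: "'a \<Rightarrow> real"
  assumes "finite (set_pmf p)" "\<And>x. x \<in> set_pmf p \<Longrightarrow> 0 \<le> u x" "0 < c"
  shows "measure_pmf.prob p {x. c \<le> u x} \<le> measure_pmf.expectation p u / c"
  using integral_Markov_inequality_measure[of p u "{}" c] assms
  by (auto simp: integrable_measure_pmf_finite AE_measure_pmf_iff)

text \<open>Union bound for a two-stage experiment: the first stage fails, or it succeeds and the
  second fails. Used twice to chain the three failure events of the algorithm.\<close>

lemma prob_bind_pmf_le:
  assumes "finite (set_pmf p)"
    and "measure_pmf.prob p {x. \<not> G x} \<le> \<delta>"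
    and "\<And>x. x \<in> set_pmf p \<Longrightarrow> G x \<Longrightarrow> measure_pmf.prob (q x) X \<le> \<delta>'"
    and "0 \<le> \<delta>'"
  shows "measure_pmf.prob (p \<bind> q) X \<le> \<delta> + \<delta>'"
proof -
  have "measure_pmf.prob (p \<bind> q) X = measure_pmf.expectation p (\<lambda>x. measure_pmf.prob (q x) X)"
  proof -
    have "ennreal (measure_pmf.prob (p \<bind> q) X) = (\<integral>\<^sup>+x. ennreal (measure_pmf.prob (q x) X) \<partial>p)"
      by (simp add: measure_pmf.emeasure_eq_measure[symmetric])
    also have "\<dots> = ennreal (measure_pmf.expectation p (\<lambda>x. measure_pmf.prob (q x) X))"
      using assms(1) by (intro nn_integral_eq_integral integrable_measure_pmf_finite) auto
    finally show ?thesis by simp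
  qed
  also have "\<dots> \<le> measure_pmf.expectation p (\<lambda>x. of_bool (\<not> G x) + \<delta>')"
  proof (rule expectation_mono_pmf_finite[OF assms(1)])
    fix x assume "x \<in> set_pmf p"
    moreover have "measure_pmf.prob (q x) X \<le> 1 + \<delta>'"
      using measure_pmf.prob_le_1[of "q x" X] assms(4) by linarith
    ultimately show "measure_pmf.prob (q x) X \<le> of_bool (\<not> G x) + \<delta>'"
      using assms(3)[of x] by (cases "G x") auto
  qed
  also have "\<dots> = measure_pmf.prob p {x. \<not> G x} + \<delta>'"
    using assms(1) unfolding expectation_of_bool[symmetric]
    by (subst Bochner_Integration.integral_add) (auto intro: integrable_measure_pmf_finite)
  finally show ?thesis using assms(2) by simp
qed

section \<open>Second moments and tails of empirical means\<close>

lemma finite_set_replicate_pmf: "finite (set_pmf p) \<Longrightarrow> finite (set_pmf (replicate_pmf N p))"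
  by (induction N) auto

text \<open>Variances of independent samples add up, and each is at most the second moment, hence at
  most \<open>B\<^sup>2\<close>.\<close>

lemma replicate_pmf_second_moment:
  fixes Z :: "'a \<Rightarrow> real"
  assumes fin: "finite (set_pmf p)" and B: "\<And>x. x \<in> set_pmf p \<Longrightarrow> \<bar>Z x\<bar> \<le> B"
    and \<mu>: "\<mu> = measure_pmf.expectation p Z"
  shows "measure_pmf.expectation (replicate_pmf N p) (\<lambda>xs. ((\<Sum>x\<leftarrow>xs. Z x) - real N * \<mu>)\<^sup>2)
    \<le> real N * B\<^sup>2"
proof (induction N)
  case 0
  then show ?case by simp
next
  case (Suc N)
  let ?q = "replicate_pmf N p"
  let ?D = "\<lambda>xs. (\<Sum>x\<leftarrow>xs. Z x) - real N * \<mu>"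
  note int = integrable_measure_pmf_finite[OF fin]
    integrable_measure_pmf_finite[OF finite_set_replicate_pmf[OF fin]]
  \<comment> \<open>This makes the cross term vanish when the square is expanded below.\<close>
  have centred: "measure_pmf.expectation p (\<lambda>x. Z x - \<mu>) = 0"
    by (simp add: \<mu> int)
  have var: "measure_pmf.expectation p (\<lambda>x. (Z x - \<mu>)\<^sup>2) \<le> B\<^sup>2"
  proof -
    have "measure_pmf.expectation p (\<lambda>x. (Z x - \<mu>)\<^sup>2)
        = measure_pmf.expectation p (\<lambda>x. (Z x)\<^sup>2 - 2 * \<mu> * (Z x - \<mu>) - \<mu>\<^sup>2)"
      by (intro Bochner_Integration.integral_cong) (auto simp: power2_eq_square algebra_simps)
    also have "\<dots> = measure_pmf.expectation p (\<lambda>x. (Z x)\<^sup>2) - \<mu>\<^sup>2"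
      using centred by (simp add: int)
    also have "\<dots> \<le> measure_pmf.expectation p (\<lambda>x. B\<^sup>2)"
    proof -
      have "measure_pmf.expectation p (\<lambda>x. (Z x)\<^sup>2) \<le> measure_pmf.expectation p (\<lambda>x. B\<^sup>2)"
        using B by (intro expectation_mono_pmf_finite[OF fin]) (simp add: abs_le_square_iff[symmetric] order_trans[OF _ abs_ge_self])
      then show ?thesis using zero_le_power2[of \<mu>] by linarith
    qed
    finally show ?thesis by simp
  qed
  have "measure_pmf.expectation (replicate_pmf (Suc N) p)
        (\<lambda>xs. ((\<Sum>x\<leftarrow>xs. Z x) - real (Suc N) * \<mu>)\<^sup>2)
      = measure_pmf.expectation p (\<lambda>x. measure_pmf.expectation ?q
          (\<lambda>xs. ((Z x - \<mu>) + ?D xs)\<^sup>2))"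
    using fin finite_set_replicate_pmf[OF fin]
    by (simp add: expectation_bind_pmf_finite algebra_simps)
  also have "\<dots> = measure_pmf.expectation p (\<lambda>x. measure_pmf.expectation ?q
          (\<lambda>xs. (Z x - \<mu>)\<^sup>2 + 2 * (Z x - \<mu>) * ?D xs + (?D xs)\<^sup>2))"
    by (simp only: power2_sum add.commute add.left_commute mult.assoc mult.commute mult.left_commute)
  also have "\<dots> = measure_pmf.expectation p (\<lambda>x. (Z x - \<mu>)\<^sup>2
        + (Z x - \<mu>) * (2 * measure_pmf.expectation ?q ?D)
        + measure_pmf.expectation ?q (\<lambda>xs. (?D xs)\<^sup>2))"
    by (simp add: int) (simp add: algebra_simps)
  also have "\<dots> = measure_pmf.expectation p (\<lambda>x. (Z x - \<mu>)\<^sup>2)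
      + measure_pmf.expectation p (\<lambda>x. Z x - \<mu>) * (2 * measure_pmf.expectation ?q ?D)
      + measure_pmf.expectation ?q (\<lambda>xs. (?D xs)\<^sup>2)"
    by (simp add: int algebra_simps)
  also have "\<dots> \<le> real (Suc N) * B\<^sup>2"
    using var Suc.IH unfolding centred by (simp add: algebra_simps)
  finally show ?case .
qed

definition mean :: "('a \<Rightarrow> real) \<Rightarrow> 'a list \<Rightarrow> real" where
  "mean Z xs = (\<Sum>x\<leftarrow>xs. Z x) / real (length xs)"

lemma replicate_pmf_mean_square:
  fixes Z :: "'a \<Rightarrow> real"
  assumes "finite (set_pmf p)" "\<And>x. x \<in> set_pmf p \<Longrightarrow> \<bar>Z x\<bar> \<le> B" "0 < N"
  shows "measure_pmf.expectation (replicate_pmf N p)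
      (\<lambda>xs. (mean Z xs - measure_pmf.expectation p Z)\<^sup>2) \<le> B\<^sup>2 / real N"
proof -
  let ?\<mu> = "measure_pmf.expectation p Z"
  have "measure_pmf.expectation (replicate_pmf N p) (\<lambda>xs. (mean Z xs - ?\<mu>)\<^sup>2)
      = measure_pmf.expectation (replicate_pmf N p)
          (\<lambda>xs. ((\<Sum>x\<leftarrow>xs. Z x) - real N * ?\<mu>)\<^sup>2 / (real N)\<^sup>2)"
    using \<open>0 < N\<close>
    by (intro integral_cong_AE AE_pmfI)
       (auto simp: mean_def set_replicate_pmf power_divide[symmetric] diff_divide_distrib)
  also have "\<dots> \<le> real N * B\<^sup>2 / (real N)\<^sup>2"
    using replicate_pmf_second_moment[OF assms(1,2) refl] by (simp add: divide_right_mono)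
  also have "\<dots> = B\<^sup>2 / real N" using \<open>0 < N\<close> by (simp add: power2_eq_square)
  finally show ?thesis .
qed

text \<open>Chebyshev: Markov's inequality for the squared deviation.\<close>

lemma replicate_pmf_mean_tail:
  fixes Z :: "'a \<Rightarrow> real"
  assumes "finite (set_pmf p)" "\<And>x. x \<in> set_pmf p \<Longrightarrow> \<bar>Z x\<bar> \<le> B" "0 < N" "0 < t"
  shows "measure_pmf.prob (replicate_pmf N p)
      {xs. t \<le> \<bar>mean Z xs - measure_pmf.expectation p Z\<bar>} \<le> B\<^sup>2 / (real N * t\<^sup>2)"
proof -
  have "{xs. t \<le> \<bar>mean Z xs - measure_pmf.expectation p Z\<bar>}
      = {xs. t\<^sup>2 \<le> (mean Z xs - measure_pmf.expectation p Z)\<^sup>2}"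
    using \<open>0 < t\<close> by (simp add: abs_le_square_iff[symmetric])
  then have "measure_pmf.prob (replicate_pmf N p) {xs. t \<le> \<bar>mean Z xs - measure_pmf.expectation p Z\<bar>}
      \<le> measure_pmf.expectation (replicate_pmf N p)
          (\<lambda>xs. (mean Z xs - measure_pmf.expectation p Z)\<^sup>2) / t\<^sup>2"
    using markov_pmf_finite[OF finite_set_replicate_pmf[OF assms(1)],
        of N "\<lambda>xs. (mean Z xs - measure_pmf.expectation p Z)\<^sup>2" "t\<^sup>2"] \<open>0 < t\<close> by simp
  also have "\<dots> \<le> B\<^sup>2 / real N / t\<^sup>2"
    by (intro divide_right_mono replicate_pmf_mean_square assms) auto
  finally show ?thesis by simp
qed

subsection \<open>Damped influences\<close>

text \<open>The value for which \<open>l * noise k ^ l\<close> peaks at \<open>l = k\<close>. For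
  \<open>k = 0\<close> it is 0, and \<open>0 ^ 0 = 1\<close> leaves the empty set undamped.\<close>

definition noise :: "nat \<Rightarrow> real" where
  "noise k = real k / (real k + 1)"

lemma noise_bounds: "0 \<le> noise k" "noise k < 1"
  by (auto simp: noise_def)

text \<open>Consecutive terms compare as \<open>l\<close> with \<open>noise k * (l + 1)\<close>,
  i.e. as \<open>l\<close> with \<open>k\<close>: the sequence rises up to \<open>l = k\<close> and
  falls afterwards.\<close>

lemma mult_noise_power_le: "real l * noise k ^ l \<le> real k * noise k ^ k"
proof -
  have step: "real (Suc l) * noise k ^ Suc l = (noise k * (real l + 1)) * noise k ^ l" for l
    by simp
  show ?thesis
  proof (cases "l \<le> k")
    case True
    then show ?thesis
    proof (induction rule: inc_induct)
      case (step l)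
      have "real l \<le> noise k * (real l + 1)"
        using step by (simp add: noise_def field_simps)
      then have "real l * noise k ^ l \<le> real (Suc l) * noise k ^ Suc l"
        unfolding \<open>\<And>l. real (Suc l) * noise k ^ Suc l = (noise k * (real l + 1)) * noise k ^ l\<close>
        by (intro mult_right_mono) (simp_all add: noise_bounds)
      then show ?case using step by linarith
    qed simp
  next
    case False
    then have "k \<le> l" by simp
    then show ?thesis
    proof (induction rule: dec_induct)
      case (step l)
      have "noise k * (real l + 1) \<le> real l"
        using step by (simp add: noise_def field_simps)
      then have "real (Suc l) * noise k ^ Suc l \<le> real l * noise k ^ l"
        unfolding \<open>\<And>l. real (Suc l) * noise k ^ Suc l = (noise k * (real l + 1)) * noise k ^ l\<close>
        by (intro mult_right_mono) (simp_all add: noise_bounds)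
      then show ?case using step by linarith
    qed simp
  qed
qed

text \<open>For positive \<open>k\<close>, \<open>noise k\<close> is the inverse of
  \<open>1 + 1 / k\<close>, whose \<open>k\<close>-th power is at most e, and e is at most 3.
  Damping thus costs only a constant factor on sets of size at most \<open>k\<close>.\<close>

lemma noise_power_ge: "1 / 3 \<le> noise k ^ k"
proof (cases "k = 0")
  case False
  have "(1 + 1 / real k) ^ k \<le> exp (1 / real k) ^ k"
    by (intro power_mono exp_ge_add_one_self) auto
  also have "\<dots> = exp 1" using False by (simp add: exp_of_nat_mult[symmetric])
  also have "\<dots> \<le> 3" by (rule exp_le)
  finally have "(1 + 1 / real k) ^ k \<le> 3" .
  moreover have "noise k * (1 + 1 / real k) = 1"
    using False by (simp add: noise_def divide_simps)
  then have "noise k ^ k * (1 + 1 / real k) ^ k = 1"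
    by (simp add: power_mult_distrib[symmetric])
  moreover have "0 \<le> noise k ^ k" by (simp add: noise_bounds)
  ultimately have "1 \<le> noise k ^ k * 3" by (metis mult_left_mono)
  then show ?thesis by simp
qed simp

lemma noise_power_pos: "0 < noise k ^ k"
  using noise_power_ge[of k] by linarith

definition noisy_weight :: "nat \<Rightarrow> ((nat \<Rightarrow> real) \<Rightarrow> real) \<Rightarrow> nat \<Rightarrow> nat set \<Rightarrow> real" where
  "noisy_weight n f k U = noise k ^ card U * (fourier n f U)\<^sup>2"

definition influence :: "nat \<Rightarrow> ((nat \<Rightarrow> real) \<Rightarrow> real) \<Rightarrow> nat \<Rightarrow> nat set \<Rightarrow> real" where
  "influence n f k B = (\<Sum>U | U \<subseteq> {..<n} \<and> U \<inter> B \<noteq> {}. noisy_weight n f k U)"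

lemma noisy_weight_nonneg: "0 \<le> noisy_weight n f k U"
  by (simp add: noisy_weight_def noise_bounds)

lemma finite_meeting: "finite {U. U \<subseteq> {..<n::nat} \<and> P U}"
  by (rule finite_subset[of _ "Pow {..<n}"]) auto

lemma influence_nonneg: "0 \<le> influence n f k B"
  unfolding influence_def by (intro sum_nonneg noisy_weight_nonneg)

lemma influence_mono: "A \<subseteq> B \<Longrightarrow> influence n f k A \<le> influence n f k B"
  unfolding influence_def by (intro sum_mono2 noisy_weight_nonneg finite_meeting) auto

text \<open>Double counting: \<open>U\<close> occurs once for each of its elements in
  \<open>B\<close>.\<close>

lemma sum_influence_eq:
  assumes "finite B"
  shows "(\<Sum>i\<in>B. influence n f k {i}) = (\<Sum>U\<in>Pow {..<n}. real (card (U \<inter> B)) * noisy_weight n f k U)"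
proof -
  have "(\<Sum>i\<in>B. influence n f k {i})
      = (\<Sum>i\<in>B. \<Sum>U\<in>Pow {..<n}. if i \<in> U then noisy_weight n f k U else 0)"
    unfolding influence_def
    by (intro sum.cong refl sum.mono_neutral_cong_left) (auto split: if_splits)
  also have "\<dots> = (\<Sum>U\<in>Pow {..<n}. \<Sum>i\<in>B. if i \<in> U then noisy_weight n f k U else 0)"
    by (rule sum.swap)
  also have "\<dots> = (\<Sum>U\<in>Pow {..<n}. real (card (U \<inter> B)) * noisy_weight n f k U)"
    using assms by (simp add: sum.If_cases Int_commute)
  finally show ?thesis .
qed

lemma influence_subadditive:
  assumes "finite B"
  shows "influence n f k B \<le> (\<Sum>i\<in>B. influence n f k {i})"
proof -
  have "influence n f k B = (\<Sum>U\<in>Pow {..<n}. if U \<inter> B \<noteq> {} then noisy_weight n f k U else 0)"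
    unfolding influence_def by (intro sum.mono_neutral_cong_left) auto
  also have "\<dots> \<le> (\<Sum>U\<in>Pow {..<n}. real (card (U \<inter> B)) * noisy_weight n f k U)"
  proof (intro sum_mono)
    fix U
    have "U \<inter> B \<noteq> {} \<Longrightarrow> 1 \<le> real (card (U \<inter> B))"
      using assms by (simp add: Suc_le_eq card_gt_0_iff)
    then show "(if U \<inter> B \<noteq> {} then noisy_weight n f k U else 0)
        \<le> real (card (U \<inter> B)) * noisy_weight n f k U"
      using mult_right_mono[of 1 "real (card (U \<inter> B))" "noisy_weight n f k U"] noisy_weight_nonneg[of n f k U] by auto
  qed
  finally show ?thesis using sum_influence_eq[OF assms] by simp
qed

text \<open>After double counting, \<open>U\<close> carries its size times its damping factor, which
  \<open>mult_noise_power_le\<close> bounds uniformly; the total Fourier weight is 1.\<close>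

lemma sum_influence_le:
  assumes "f \<in> boolean_functions n"
  shows "(\<Sum>i<n. influence n f k {i}) \<le> real k * noise k ^ k"
proof -
  have "(\<Sum>i<n. influence n f k {i}) = (\<Sum>U\<in>Pow {..<n}. real (card U) * noisy_weight n f k U)"
    by (subst sum_influence_eq) (auto intro!: sum.cong simp: Int_absorb2)
  also have "\<dots> \<le> (\<Sum>U\<in>Pow {..<n}. real k * noise k ^ k * (fourier n f U)\<^sup>2)"
    unfolding noisy_weight_def mult.assoc[symmetric]
    by (intro sum_mono mult_right_mono mult_noise_power_le) simp
  also have "\<dots> = real k * noise k ^ k"
    by (simp add: sum_distrib_left[symmetric] sum_fourier_square[OF assms])
  finally show ?thesis .
qed

text \<open>The weight lost sits on subsets of \<open>T\<close> that meet \<open>T - R\<close>. They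
  have size at most \<open>k\<close>, so undoing their damping costs at most the factor
  \<open>1 / noise k ^ k\<close>.\<close>

lemma cond_l1_le_add_influence:
  assumes "T \<subseteq> {..<n}" "card T \<le> k"
  shows "cond_l1 n f T \<le> cond_l1 n f (T \<inter> R) + sqrt (influence n f k (T - R) / noise k ^ k)"
proof -
  note pos = noise_power_pos[of k]
  have finT: "finite T" using assms(1) finite_subset by auto
  have "noise k ^ k * (\<Sum>U\<in>Pow T - Pow (T \<inter> R). (fourier n f U)\<^sup>2)
      \<le> (\<Sum>U\<in>Pow T - Pow (T \<inter> R). noisy_weight n f k U)"
    unfolding sum_distrib_left noisy_weight_def
  proof (intro sum_mono mult_right_mono power_decreasing)
    fix U assume "U \<in> Pow T - Pow (T \<inter> R)"
    then show "card U \<le> k" using card_mono[OF finT, of U] assms(2) by auto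
  qed (use noise_bounds[of k] in auto)
  also have "\<dots> \<le> influence n f k (T - R)"
    unfolding influence_def
    by (intro sum_mono2 noisy_weight_nonneg finite_meeting) (use assms in auto)
  finally have "(\<Sum>U\<in>Pow T - Pow (T \<inter> R). (fourier n f U)\<^sup>2) \<le> influence n f k (T - R) / noise k ^ k"
    using pos by (simp add: field_simps)
  then show ?thesis
    using cond_l1_diff_le[OF Int_lower1 assms(1), of f R] real_sqrt_le_mono order_trans add_left_mono
    by meson
qed

text \<open>Take the coordinates \<open>T\<close> of a best junta. At most \<open>k\<close> of them
  lie outside \<open>R\<close>, so together they lose at most the square root of
  \<open>9 / 4 * \<epsilon>\<^sup>2\<close>.\<close>

lemma max_junta_correlation_le_of_light:
  assumes "R \<subseteq> {..<n}" "0 < \<epsilon>"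
    and light: "\<And>i. i < n \<Longrightarrow> i \<notin> R \<Longrightarrow> real k * influence n f k {i} \<le> 9 / 4 * (noise k ^ k * \<epsilon>\<^sup>2)"
  shows "max_junta_correlation n (real k) f \<le> cond_l1 n f R + 3 / 2 * \<epsilon>"
proof -
  obtain T where T: "T \<subseteq> {..<n}" "real (card T) \<le> real k"
      "max_junta_correlation n (real k) f \<le> cond_l1 n f T"
    by (rule max_junta_correlation_le_cond_l1[of "real k"]) auto
  note pos = noise_power_pos[of k]
  have finT: "finite (T - R)" using T(1) finite_subset by auto
  have "influence n f k (T - R) / noise k ^ k \<le> (3 / 2 * \<epsilon>)\<^sup>2"
  \<comment> \<open>The bounds on influences are multiplied by \<open>k\<close>, so
    \<open>k = 0\<close> is separate; there \<open>T\<close> is empty.\<close>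
  proof (cases "k = 0")
    case True
    then have "T = {}" using T finite_subset by fastforce
    then show ?thesis by (simp add: influence_def)
  next
    case False
    have "real k * influence n f k (T - R) \<le> (\<Sum>i\<in>T - R. real k * influence n f k {i})"
      using influence_subadditive[OF finT] by (simp add: sum_distrib_left[symmetric] mult_left_mono)
    also have "\<dots> \<le> real (card (T - R)) * (9 / 4 * (noise k ^ k * \<epsilon>\<^sup>2))"
      using T(1) by (intro sum_bounded_above light) auto
    also have "\<dots> \<le> real k * (9 / 4 * (noise k ^ k * \<epsilon>\<^sup>2))"
    proof (intro mult_right_mono)
      have "card (T - R) \<le> card T" using T(1) by (intro card_mono) (auto intro: finite_subset)
      then show "real (card (T - R)) \<le> real k" using T(2) by linarith
    qed (use pos in auto)
    finally have "influence n f k (T - R) \<le> 9 / 4 * (noise k ^ k * \<epsilon>\<^sup>2)"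
      using False by simp
    then show ?thesis using pos by (simp add: field_simps power2_eq_square)
  qed
  then have "sqrt (influence n f k (T - R) / noise k ^ k) \<le> 3 / 2 * \<epsilon>"
    using \<open>0 < \<epsilon>\<close> by (intro real_le_lsqrt) (auto simp: influence_nonneg pos less_imp_le)
  then show ?thesis
    using T cond_l1_le_add_influence[OF T(1), of k f R] cond_l1_mono[of "T \<inter> R" R n f] by auto
qed

text \<open>The threshold \<open>noise k ^ k * \<epsilon>\<^sup>2 / k\<close> is multiplied out, so
  that for \<open>k = 0\<close> and positive \<open>\<epsilon>\<close> no coordinate is
  heavy.\<close>

definition heavy :: "nat \<Rightarrow> ((nat \<Rightarrow> real) \<Rightarrow> real) \<Rightarrow> nat \<Rightarrow> real \<Rightarrow> nat set" where
  "heavy n f k \<epsilon> = {i \<in> {..<n}. noise k ^ k * \<epsilon>\<^sup>2 \<le> real k * influence n f k {i}}"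

text \<open>Each heavy coordinate takes its share of the total from \<open>sum_influence_le\<close>;
  the factor \<open>noise k ^ k\<close> cancels, leaving exactly the junta size allowed in the upper
  bound.\<close>

lemma card_heavy_le:
  assumes "f \<in> boolean_functions n" "0 < \<epsilon>"
  shows "real (card (heavy n f k \<epsilon>)) \<le> (real k)\<^sup>2 / \<epsilon>\<^sup>2"
proof -
  note pos = noise_power_pos[of k]
  have "real (card (heavy n f k \<epsilon>)) * (noise k ^ k * \<epsilon>\<^sup>2)
      \<le> (\<Sum>i\<in>heavy n f k \<epsilon>. real k * influence n f k {i})"
    by (intro sum_bounded_below) (auto simp: heavy_def)
  also have "\<dots> \<le> (\<Sum>i<n. real k * influence n f k {i})"
    by (intro sum_mono2) (auto simp: heavy_def influence_nonneg)
  also have "\<dots> \<le> real k * (real k * noise k ^ k)"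
    using sum_influence_le[OF assms(1)] by (simp add: sum_distrib_left[symmetric] mult_left_mono)
  finally have "(real (card (heavy n f k \<epsilon>)) * \<epsilon>\<^sup>2) * noise k ^ k \<le> (real k)\<^sup>2 * noise k ^ k"
    by (simp add: power2_eq_square mult_ac)
  then have "real (card (heavy n f k \<epsilon>)) * \<epsilon>\<^sup>2 \<le> (real k)\<^sup>2" using pos by simp
  then show ?thesis using assms(2) by (simp add: field_simps)
qed

subsection \<open>Hashing the coordinates\<close>

definition hash_preimage :: "nat \<Rightarrow> (nat \<Rightarrow> nat) \<Rightarrow> nat set \<Rightarrow> nat set" where
  "hash_preimage n h D = {i \<in> {..<n}. h i \<in> D}"

definition collision_mass :: "nat \<Rightarrow> (nat \<Rightarrow> nat) \<Rightarrow> (nat \<Rightarrow> real) \<Rightarrow> real" where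
  "collision_mass n h v = (\<Sum>i<n. \<Sum>j\<in>{..<n} - {i}. of_bool (h i = h j) * (v i * v j))"

text \<open>If the bucket has total \<open>s\<close> and all its entries are below \<open>u\<close>,
  its pairs contribute at least \<open>s * (s - u)\<close>, and
  \<open>5 / 4 * (1 / 4) = 5 / 16\<close>.\<close>

lemma collision_mass_ge:
  assumes v: "\<And>i. i < n \<Longrightarrow> 0 \<le> v i" and B: "B = hash_preimage n h {b}"
    and light: "\<And>i. i \<in> B \<Longrightarrow> v i < u" and "0 < u" and sum: "5 / 4 * u \<le> sum v B"
  shows "5 / 16 * u\<^sup>2 \<le> collision_mass n h v"
proof -
  define s where "s = sum v B"
  have B': "finite B" "B \<subseteq> {..<n}" "\<And>i. i \<in> B \<Longrightarrow> h i = b" using B by (auto simp: hash_preimage_def)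
  have "(5 / 4 * u) * (1 / 4 * u) \<le> s * (s - u)"
    using sum \<open>0 < u\<close> by (intro mult_mono) (auto simp: s_def)
  also have "\<dots> = (\<Sum>i\<in>B. v i * (s - u))" by (simp add: s_def sum_distrib_right)
  also have "\<dots> \<le> (\<Sum>i\<in>B. v i * (s - v i))"
    using v light B' by (intro sum_mono mult_left_mono) (auto intro: less_imp_le)
  also have "\<dots> = (\<Sum>i\<in>B. \<Sum>j\<in>B - {i}. of_bool (h i = h j) * (v i * v j))"
  proof (intro sum.cong refl)
    fix i assume i: "i \<in> B"
    have "v i * (s - v i) = (\<Sum>j\<in>B - {i}. v i * v j)"
      using B' i by (simp add: s_def sum_diff1 sum_distrib_left[symmetric])
    also have "\<dots> = (\<Sum>j\<in>B - {i}. of_bool (h i = h j) * (v i * v j))"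
      using B' i by (intro sum.cong) auto
    finally show "v i * (s - v i) = (\<Sum>j\<in>B - {i}. of_bool (h i = h j) * (v i * v j))" .
  qed
  also have "\<dots> \<le> (\<Sum>i\<in>B. \<Sum>j\<in>{..<n} - {i}. of_bool (h i = h j) * (v i * v j))"
    using B' v by (intro sum_mono sum_mono2) auto
  also have "\<dots> \<le> collision_mass n h v"
    unfolding collision_mass_def using B' v
    by (intro sum_mono2) (auto intro!: sum_nonneg)
  finally show ?thesis by (simp add: power2_eq_square)
qed

text \<open>The weight picked up by mistake when \<open>S\<close> is replaced by the union of the
  buckets that it hits.\<close>

definition spill :: "nat \<Rightarrow> ((nat \<Rightarrow> real) \<Rightarrow> real) \<Rightarrow> (nat \<Rightarrow> nat) \<Rightarrow> nat set \<Rightarrow> real" where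
  "spill n f h S = (\<Sum>U\<in>Pow (hash_preimage n h (h ` S)) - Pow S. (fourier n f U)\<^sup>2)"

text \<open>The first bound contradicts \<open>collision_mass_ge\<close>, so no influential bucket
  consists of light coordinates only. The second makes the square root of the spill at most
  \<open>\<epsilon> / 8\<close>.\<close>

definition good_hash :: "nat \<Rightarrow> ((nat \<Rightarrow> real) \<Rightarrow> real) \<Rightarrow> nat \<Rightarrow> real \<Rightarrow> (nat \<Rightarrow> nat) \<Rightarrow> bool" where
  "good_hash n f k \<epsilon> h \<longleftrightarrow>
     collision_mass n h (\<lambda>i. real k * influence n f k {i}) < 5 / 16 * (noise k ^ k * \<epsilon>\<^sup>2)\<^sup>2 \<and>
     spill n f h (heavy n f k \<epsilon>) < \<epsilon>\<^sup>2 / 64"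

lemma good_hash_upper:
  assumes f: "f \<in> boolean_functions n" and \<epsilon>: "0 < \<epsilon>" and good: "good_hash n f k \<epsilon> h"
    and D: "\<And>b. b \<in> D \<Longrightarrow>
      5 / 4 * (noise k ^ k * \<epsilon>\<^sup>2) \<le> real k * influence n f k (hash_preimage n h {b})"
  shows "cond_l1 n f (hash_preimage n h D) \<le> max_junta_correlation n ((real k)\<^sup>2 / \<epsilon>\<^sup>2) f + \<epsilon> / 8"
proof -
  let ?S = "heavy n f k \<epsilon>" and ?u = "noise k ^ k * \<epsilon>\<^sup>2"
  have u: "0 < ?u" using noise_power_pos[of k] \<epsilon> by simp
  \<comment> \<open>A chosen bucket without heavy coordinates would consist of light ones with a
    large total, forcing too much collision mass.\<close>
  have "D \<subseteq> h ` ?S"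
  proof (rule ccontr)
    assume "\<not> D \<subseteq> h ` ?S"
    then obtain b where b: "b \<in> D" "b \<notin> h ` ?S" by auto
    let ?B = "hash_preimage n h {b}"
    have fin: "finite ?B" by (simp add: hash_preimage_def)
    have "real k * influence n f k ?B \<le> (\<Sum>i\<in>?B. real k * influence n f k {i})"
      using influence_subadditive[OF fin] by (simp add: sum_distrib_left[symmetric] mult_left_mono)
    with D[OF b(1)] have sum: "5 / 4 * ?u \<le> (\<Sum>i\<in>?B. real k * influence n f k {i})" by linarith
    have "real k * influence n f k {i} < ?u" if "i \<in> ?B" for i
      using that b(2) by (force simp: hash_preimage_def heavy_def)
    then have "5 / 16 * ?u\<^sup>2 \<le> collision_mass n h (\<lambda>i. real k * influence n f k {i})"
      by (intro collision_mass_ge[OF _ refl _ u sum]) (simp_all add: influence_nonneg)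
    then show False using good by (simp add: good_hash_def)
  qed
  then have sub: "hash_preimage n h D \<subseteq> hash_preimage n h (h ` ?S)"
    by (auto simp: hash_preimage_def)
  have S: "?S \<subseteq> hash_preimage n h (h ` ?S)" "hash_preimage n h (h ` ?S) \<subseteq> {..<n}" "?S \<subseteq> {..<n}"
    by (auto simp: hash_preimage_def heavy_def)
  have "sqrt (spill n f h ?S) \<le> sqrt (\<epsilon>\<^sup>2 / 64)"
    using good by (intro real_sqrt_le_mono) (simp add: good_hash_def)
  also have "\<dots> = \<epsilon> / 8" using \<epsilon> by (simp add: real_sqrt_divide)
  finally have "sqrt (spill n f h ?S) \<le> \<epsilon> / 8" .
  then show ?thesis
    using cond_l1_mono[OF sub, of n f] cond_l1_diff_le[OF S(1,2), of f]
      cond_l1_le_max_junta_correlation[OF S(3) card_heavy_le[OF f \<epsilon>], of f]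
    unfolding spill_def by linarith
qed

text \<open>This direction holds for every hash function: a coordinate in a rejected bucket is at
  most as influential as its bucket, hence light.\<close>

lemma hash_lower:
  assumes \<epsilon>: "0 < \<epsilon>"
    and D: "\<And>i. i < n \<Longrightarrow> h i \<notin> D \<Longrightarrow>
      real k * influence n f k (hash_preimage n h {h i}) \<le> 9 / 4 * (noise k ^ k * \<epsilon>\<^sup>2)"
  shows "max_junta_correlation n (real k) f \<le> cond_l1 n f (hash_preimage n h D) + 3 / 2 * \<epsilon>"
proof (rule max_junta_correlation_le_of_light[OF _ \<epsilon>])
  fix i assume i: "i < n" "i \<notin> hash_preimage n h D"
  then have "influence n f k {i} \<le> influence n f k (hash_preimage n h {h i})"
    by (intro influence_mono) (auto simp: hash_preimage_def)
  then have "real k * influence n f k {i} \<le> real k * influence n f k (hash_preimage n h {h i})"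
    by (simp add: mult_left_mono)
  also have "\<dots> \<le> 9 / 4 * (noise k ^ k * \<epsilon>\<^sup>2)"
    using i by (intro D) (auto simp: hash_preimage_def)
  finally show "real k * influence n f k {i} \<le> 9 / 4 * (noise k ^ k * \<epsilon>\<^sup>2)" .
qed (auto simp: hash_preimage_def)

section \<open>Random hash functions are good with high probability\<close>

definition hash_pmf :: "nat \<Rightarrow> nat \<Rightarrow> (nat \<Rightarrow> nat) pmf" where
  "hash_pmf n M = Pi_pmf {..<n} 0 (\<lambda>_. pmf_of_set {..<M})"

lemma set_hash_pmf:
  assumes "0 < M"
  shows "finite (set_pmf (hash_pmf n M))"
    and "h \<in> set_pmf (hash_pmf n M) \<Longrightarrow> i < n \<Longrightarrow> h i < M"
proof -
  have "{..<M} \<noteq> {}" using assms by auto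
  then have eq: "set_pmf (hash_pmf n M) = PiE_dflt {..<n} 0 (\<lambda>_. {..<M})"
    by (simp add: hash_pmf_def set_Pi_pmf o_def)
  show "finite (set_pmf (hash_pmf n M))" unfolding eq by auto
  show "h \<in> set_pmf (hash_pmf n M) \<Longrightarrow> i < n \<Longrightarrow> h i < M"
    unfolding eq PiE_dflt_def by auto
qed

lemma hash_collision_prob:
  assumes "0 < M" "i < n" "j < n" "i \<noteq> j"
  shows "measure_pmf.prob (hash_pmf n M) {h. h i = h j} \<le> 1 / real M"
proof -
  have ne: "{..<M} \<noteq> {}" using assms by auto
  have "measure_pmf.prob (hash_pmf n M) {h. h i = h j}
      = measure_pmf.prob (hash_pmf n M) ({h. h i = h j} \<inter> set_pmf (hash_pmf n M))"
    by (simp add: measure_Int_set_pmf)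
  also have "\<dots> \<le> measure_pmf.prob (hash_pmf n M) (\<Union>b<M. {h. h i = b \<and> h j = b})"
    using set_hash_pmf(2)[OF assms(1)] assms by (intro measure_pmf.finite_measure_mono) auto
  also have "\<dots> \<le> (\<Sum>b<M. measure_pmf.prob (hash_pmf n M) {h. h i = b \<and> h j = b})"
    by (intro measure_pmf.finite_measure_subadditive_finite) auto
  also have "\<dots> = (\<Sum>b<M. 1 / real M * (1 / real M))"
  proof (intro sum.cong refl)
    fix b assume b: "b \<in> {..<M}"
    \<comment> \<open>The event is a product set constraining only two coordinates, so independence
      leaves two factors.\<close>
    let ?B = "\<lambda>x. if x \<in> {i, j} then {b} else UNIV"
    have "{h. h i = b \<and> h j = b} = Pi {..<n} ?B"
      using assms by (auto simp: Pi_iff split: if_splits)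
    then have "measure_pmf.prob (hash_pmf n M) {h. h i = b \<and> h j = b}
        = (\<Prod>x<n. measure_pmf.prob (pmf_of_set {..<M}) (?B x))"
      unfolding hash_pmf_def by (simp add: measure_Pi_pmf_Pi)
    also have "\<dots> = (\<Prod>x\<in>{i, j}. measure_pmf.prob (pmf_of_set {..<M}) {b})"
      using assms by (intro prod.mono_neutral_cong_right) auto
    also have "\<dots> = 1 / real M * (1 / real M)"
      using b assms ne by (simp add: measure_pmf_of_set)
    finally show "measure_pmf.prob (hash_pmf n M) {h. h i = b \<and> h j = b} = 1 / real M * (1 / real M)" .
  qed
  also have "\<dots> = 1 / real M" using assms by simp
  finally show ?thesis .
qed

text \<open>Each pair collides with probability at most \<open>1 / M\<close>; adding the diagonal
  completes the square.\<close>

lemma expectation_collision_mass: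
  assumes M: "0 < M" and v: "\<And>i. i < n \<Longrightarrow> 0 \<le> v i"
  shows "measure_pmf.expectation (hash_pmf n M) (\<lambda>h. collision_mass n h v) \<le> (\<Sum>i<n. v i)\<^sup>2 / real M"
proof -
  note fin = set_hash_pmf(1)[OF M, of n]
  have "measure_pmf.expectation (hash_pmf n M) (\<lambda>h. collision_mass n h v)
      = (\<Sum>i<n. \<Sum>j\<in>{..<n} - {i}. measure_pmf.prob (hash_pmf n M) {h. h i = h j} * (v i * v j))"
    unfolding collision_mass_def
    by (simp only: expectation_sum_pmf_finite[OF fin] integral_mult_left_zero expectation_of_bool)
  also have "\<dots> \<le> (\<Sum>i<n. \<Sum>j\<in>{..<n} - {i}. 1 / real M * (v i * v j))"
    using v by (intro sum_mono mult_right_mono hash_collision_prob M) auto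
  also have "\<dots> \<le> (\<Sum>i<n. \<Sum>j<n. 1 / real M * (v i * v j))"
    using v by (intro sum_mono sum_mono2) auto
  also have "\<dots> = (\<Sum>i<n. v i)\<^sup>2 / real M"
    by (simp add: power2_eq_square sum_product sum_divide_distrib)
  finally show ?thesis .
qed

text \<open>A set \<open>U\<close> not inside \<open>S\<close> has an element outside
  \<open>S\<close>, which must collide with one of the \<open>card S\<close> elements of
  \<open>S\<close>. The Fourier weights sum to 1.\<close>

lemma expectation_spill:
  assumes M: "0 < M" and f: "f \<in> boolean_functions n" and S: "S \<subseteq> {..<n}"
  shows "measure_pmf.expectation (hash_pmf n M) (\<lambda>h. spill n f h S) \<le> real (card S) / real M"
proof -
  note fin = set_hash_pmf(1)[OF M, of n]
  have finS: "finite S" using S finite_subset by auto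
  let ?P = "\<lambda>h U. U \<subseteq> hash_preimage n h (h ` S) \<and> \<not> U \<subseteq> S"
  have prob: "measure_pmf.prob (hash_pmf n M) {h. ?P h U} \<le> real (card S) / real M" 
    if U: "U \<subseteq> {..<n}" for U
  proof (cases "U \<subseteq> S")
    case False
    then obtain i where i: "i \<in> U" "i \<notin> S" by auto
    have "measure_pmf.prob (hash_pmf n M) {h. ?P h U}
        \<le> measure_pmf.prob (hash_pmf n M) (\<Union>j\<in>S. {h. h i = h j})"
      using i by (intro measure_pmf.finite_measure_mono) (auto simp: hash_preimage_def)
    also have "\<dots> \<le> (\<Sum>j\<in>S. measure_pmf.prob (hash_pmf n M) {h. h i = h j})"
      using finS by (intro measure_pmf.finite_measure_subadditive_finite) auto
    also have "\<dots> \<le> (\<Sum>j\<in>S. 1 / real M)"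
      using i U S by (intro sum_mono hash_collision_prob M) auto
    finally show ?thesis by simp
  qed simp
  have "spill n f h S = (\<Sum>U\<in>Pow {..<n}. of_bool (?P h U) * (fourier n f U)\<^sup>2)" for h
    unfolding spill_def by (intro sum.mono_neutral_cong_left) (auto simp: hash_preimage_def)
  then have "measure_pmf.expectation (hash_pmf n M) (\<lambda>h. spill n f h S)
      = (\<Sum>U\<in>Pow {..<n}. measure_pmf.prob (hash_pmf n M) {h. ?P h U} * (fourier n f U)\<^sup>2)"
    by (simp only: expectation_sum_pmf_finite[OF fin] integral_mult_left_zero expectation_of_bool)
  also have "\<dots> \<le> (\<Sum>U\<in>Pow {..<n}. real (card S) / real M * (fourier n f U)\<^sup>2)"
    by (intro sum_mono mult_right_mono prob) auto
  also have "\<dots> = real (card S) / real M"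
    unfolding sum_distrib_left[symmetric] sum_fourier_square[OF f] by simp
  finally show ?thesis .
qed

lemma prob_not_good_hash:
  assumes f: "f \<in> boolean_functions n" and \<epsilon>: "0 < \<epsilon>"
    and M: "0 < M" "1000 * (real k + 1) ^ 4 \<le> real M * \<epsilon> ^ 4"
  shows "measure_pmf.prob (hash_pmf n M) {h. \<not> good_hash n f k \<epsilon> h} \<le> 1 / 9"
proof -
  let ?p = "hash_pmf n M" and ?S = "heavy n f k \<epsilon>" and ?u = "noise k ^ k * \<epsilon>\<^sup>2"
  let ?v = "\<lambda>i. real k * influence n f k {i}"
  note fin = set_hash_pmf(1)[OF M(1), of n]
  have u: "0 < ?u" using noise_power_pos[of k] \<epsilon> by simp
  have M\<epsilon>: "0 < real M * \<epsilon> ^ 4" using M \<epsilon> by simp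
  have S: "?S \<subseteq> {..<n}" by (auto simp: heavy_def)
  have "measure_pmf.prob ?p {h. 5 / 16 * ?u\<^sup>2 \<le> collision_mass n h ?v}
      \<le> measure_pmf.expectation ?p (\<lambda>h. collision_mass n h ?v) / (5 / 16 * ?u\<^sup>2)"
  proof (rule markov_pmf_finite[OF fin])
    show "0 < 5 / 16 * ?u\<^sup>2" by (rule mult_pos_pos[OF _ zero_less_power[OF u]]) simp
  qed (auto simp: collision_mass_def influence_nonneg intro!: sum_nonneg)
  also have "\<dots> \<le> ((real k)\<^sup>2 * noise k ^ k)\<^sup>2 / real M / (5 / 16 * ?u\<^sup>2)"
  proof (intro divide_right_mono order_trans[OF expectation_collision_mass[OF M(1)]] power_mono)
    show "(\<Sum>i<n. ?v i) \<le> (real k)\<^sup>2 * noise k ^ k"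
      using sum_influence_le[OF f, of k]
      by (simp add: sum_distrib_left[symmetric] power2_eq_square mult.assoc mult_left_mono)
  qed (auto simp: influence_nonneg intro!: sum_nonneg)
  \<comment> \<open>The damping factor enters numerator and denominator with the same power and
    cancels.\<close>
  also have "\<dots> = 16 / 5 * real k ^ 4 / (real M * \<epsilon> ^ 4)"
  proof -
    have "((real k)\<^sup>2 * g)\<^sup>2 / real M / (5 / 16 * (g * \<epsilon>\<^sup>2)\<^sup>2)
        = 16 / 5 * real k ^ 4 / (real M * \<epsilon> ^ 4)" if "0 < g" for g
      using that \<epsilon> M(1) by (simp add: field_simps flip: power_mult)
    then show ?thesis using noise_power_pos .
  qed
  finally have 1: "measure_pmf.prob ?p {h. 5 / 16 * ?u\<^sup>2 \<le> collision_mass n h ?v}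
      \<le> 16 / 5 * real k ^ 4 / (real M * \<epsilon> ^ 4)" .
  have "measure_pmf.prob ?p {h. \<epsilon>\<^sup>2 / 64 \<le> spill n f h ?S}
      \<le> measure_pmf.expectation ?p (\<lambda>h. spill n f h ?S) / (\<epsilon>\<^sup>2 / 64)"
    using \<epsilon> by (intro markov_pmf_finite fin) (auto simp: spill_def intro!: sum_nonneg)
  also have "\<dots> \<le> ((real k)\<^sup>2 / \<epsilon>\<^sup>2) / real M / (\<epsilon>\<^sup>2 / 64)"
    by (intro divide_right_mono order_trans[OF expectation_spill[OF M(1) f S]] card_heavy_le f \<epsilon>) auto
  also have "\<dots> = 64 * (real k)\<^sup>2 / (real M * \<epsilon> ^ 4)"
    using \<epsilon> M(1) by (simp add: divide_simps)
  finally have 2: "measure_pmf.prob ?p {h. \<epsilon>\<^sup>2 / 64 \<le> spill n f h ?S}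
      \<le> 64 * (real k)\<^sup>2 / (real M * \<epsilon> ^ 4)" .
  have "{h. \<not> good_hash n f k \<epsilon> h}
      = {h. 5 / 16 * ?u\<^sup>2 \<le> collision_mass n h ?v} \<union> {h. \<epsilon>\<^sup>2 / 64 \<le> spill n f h ?S}"
    by (auto simp: good_hash_def)
  then have "measure_pmf.prob ?p {h. \<not> good_hash n f k \<epsilon> h}
      \<le> 16 / 5 * real k ^ 4 / (real M * \<epsilon> ^ 4) + 64 * (real k)\<^sup>2 / (real M * \<epsilon> ^ 4)"
    using 1 2 measure_Un_le[of "{h. 5 / 16 * ?u\<^sup>2 \<le> collision_mass n h ?v}" ?p
        "{h. \<epsilon>\<^sup>2 / 64 \<le> spill n f h ?S}"] by simp
  also have "\<dots> = (16 / 5 * real k ^ 4 + 64 * (real k)\<^sup>2) / (real M * \<epsilon> ^ 4)"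
    by (simp add: add_divide_distrib)
  also have "\<dots> \<le> 1 / 9"
  proof -
    have "real k ^ 4 \<le> (real k + 1) ^ 4" by (intro power_mono) auto
    moreover have "(real k)\<^sup>2 \<le> (real k + 1) ^ 4"
    proof -
      have "(real k)\<^sup>2 \<le> (real k + 1)\<^sup>2" by (intro power_mono) auto
      also have "\<dots> \<le> (real k + 1) ^ 4" by (intro power_increasing) auto
      finally show ?thesis .
    qed
    moreover have "0 \<le> (real k + 1) ^ 4" by simp
    \<comment> \<open>Here \<open>9 * (16 / 5 + 64) = 604.8\<close>, which the constant 1000 in the
      choice of \<open>M\<close> covers.\<close>
    moreover have "9 * (16 / 5 * a + 64 * b) \<le> d" if "a \<le> c" "b \<le> c" "0 \<le> c" "1000 * c \<le> d"
      for a b c d :: real using that by argo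
    ultimately have "9 * (16 / 5 * real k ^ 4 + 64 * (real k)\<^sup>2) \<le> real M * \<epsilon> ^ 4"
      using M(2) by blast
    then show ?thesis using M\<epsilon> by (simp add: divide_simps)
  qed
  finally show ?thesis .
qed

subsection \<open>Estimators\<close>

definition subset_pmf :: "nat \<Rightarrow> nat \<Rightarrow> nat set pmf" where
  "subset_pmf n k = map_pmf Collect (Pi_pmf {..<n} False (\<lambda>_. bernoulli_pmf (noise k)))"

lemma set_subset_pmf: "J \<in> set_pmf (subset_pmf n k) \<Longrightarrow> J \<subseteq> {..<n}"
  using set_Pi_pmf_subset[of "{..<n}" False "\<lambda>_. bernoulli_pmf (noise k)"]
  by (auto simp: subset_pmf_def)

lemma finite_set_subset_pmf: "finite (set_pmf (subset_pmf n k))"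
  by (rule finite_subset[of _ "Pow {..<n}"]) (auto dest: set_subset_pmf)

text \<open>The source of the damping: a set survives the random restriction with exactly its
  damping factor as probability.\<close>

lemma prob_subset_pmf:
  assumes "U \<subseteq> {..<n}"
  shows "measure_pmf.prob (subset_pmf n k) {J. U \<subseteq> J} = noise k ^ card U"
proof -
  let ?B = "\<lambda>i. if i \<in> U then {True} else UNIV"
  have "Collect -` {J. U \<subseteq> J} = Pi {..<n} ?B"
    using assms by (auto simp: Pi_iff split: if_splits)
  then have "measure_pmf.prob (subset_pmf n k) {J. U \<subseteq> J}
      = (\<Prod>i<n. measure_pmf.prob (bernoulli_pmf (noise k)) (?B i))"
    by (simp add: subset_pmf_def measure_Pi_pmf_Pi)
  also have "\<dots> = (\<Prod>i\<in>U. measure_pmf.prob (bernoulli_pmf (noise k)) {True})"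
    using assms by (intro prod.mono_neutral_cong_right) auto
  also have "\<dots> = noise k ^ card U"
    using noise_bounds[of k] by (simp add: measure_pmf_single)
  finally show ?thesis .
qed

type_synonym point = "nat \<Rightarrow> real"

definition noise_sample :: "nat \<Rightarrow> nat \<Rightarrow> (nat set \<times> point \<times> point \<times> point) pmf" where
  "noise_sample n k = pair_pmf (subset_pmf n k)
     (pair_pmf (pmf_of_set (cube n)) (pair_pmf (pmf_of_set (cube n)) (pmf_of_set (cube n))))"

text \<open>The points share \<open>x\<close> and have independent completions \<open>y\<close> and
  \<open>z\<close>, so for fixed \<open>J\<close> the two products estimate the Fourier weights
  inside \<open>J\<close> and inside \<open>J - B\<close>.\<close>

definition noise_stat ::
  "(point \<Rightarrow> real) \<Rightarrow> nat set \<Rightarrow> nat set \<times> point \<times> point \<times> point \<Rightarrow> real" where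
  "noise_stat f B = (\<lambda>(J, x, y, z). f (glue J x y) * f (glue J x z)
     - f (glue (J - B) x y) * f (glue (J - B) x z))"

definition noise_points :: "nat set \<Rightarrow> nat set \<times> point \<times> point \<times> point \<Rightarrow> point list" where
  "noise_points B = (\<lambda>(J, x, y, z).
     [glue J x y, glue J x z, glue (J - B) x y, glue (J - B) x z])"

lemma set_noise_sample:
  "set_pmf (noise_sample n k) = set_pmf (subset_pmf n k) \<times> cube n \<times> cube n \<times> cube n"
  by (simp add: noise_sample_def set_pmf_cube)

lemma finite_set_noise_sample: "finite (set_pmf (noise_sample n k))"
  by (simp add: set_noise_sample finite_set_subset_pmf finite_cube)

text \<open>Given \<open>x\<close>, the completions are independent, so the inner averages multiply
  to the square of \<open>cond_avg\<close>.\<close>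

lemma avg_product_eq_weight:
  assumes "J \<subseteq> {..<n}"
  shows "avg n (\<lambda>x. avg n (\<lambda>y. avg n (\<lambda>z. f (glue J x y) * f (glue J x z)))) = weight n f J"
  unfolding avg_cond_avg_square[OF assms, symmetric]
  by (simp add: cond_avg_def avg_cmult avg_multc power2_eq_square)

text \<open>For fixed \<open>J\<close> the difference of the two weights counts the subsets of
  \<open>J\<close> meeting \<open>B\<close>; averaging over \<open>J\<close> then inserts the
  damping.\<close>

lemma expectation_noise_stat:
  "measure_pmf.expectation (noise_sample n k) (noise_stat f B) = influence n f k B"
proof -
  note fin = finite_set_subset_pmf[of n k]
  have finU: "finite (set_pmf (pmf_of_set (cube n)))" by (simp add: set_pmf_cube finite_cube)
  have "measure_pmf.expectation (noise_sample n k) (noise_stat f B)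
      = measure_pmf.expectation (subset_pmf n k) (\<lambda>J. avg n (\<lambda>x. avg n (\<lambda>y. avg n (\<lambda>z.
          f (glue J x y) * f (glue J x z) - f (glue (J - B) x y) * f (glue (J - B) x z)))))"
    unfolding noise_sample_def avg_def noise_stat_def
    by (simp add: expectation_pair_pmf_finite fin finU)
  also have "\<dots> = measure_pmf.expectation (subset_pmf n k)
      (\<lambda>J. \<Sum>U | U \<subseteq> {..<n} \<and> U \<inter> B \<noteq> {}. of_bool (U \<subseteq> J) * (fourier n f U)\<^sup>2)"
  proof (intro integral_cong_AE AE_pmfI)
    fix J assume "J \<in> set_pmf (subset_pmf n k)"
    then have J: "J \<subseteq> {..<n}" by (rule set_subset_pmf)
    then have finJ: "finite (Pow J)" using finite_subset by auto
    have "avg n (\<lambda>x. avg n (\<lambda>y. avg n (\<lambda>z.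
          f (glue J x y) * f (glue J x z) - f (glue (J - B) x y) * f (glue (J - B) x z))))
        = weight n f J - weight n f (J - B)"
      unfolding avg_diff using J by (subst (1 2) avg_product_eq_weight) auto
    also have "\<dots> = (\<Sum>U\<in>Pow J - Pow (J - B). (fourier n f U)\<^sup>2)"
      unfolding weight_def by (subst sum_diff[OF finJ]) auto
    also have "\<dots> = (\<Sum>U | U \<subseteq> {..<n} \<and> U \<inter> B \<noteq> {}. of_bool (U \<subseteq> J) * (fourier n f U)\<^sup>2)"
      using J by (intro sum.mono_neutral_cong_left finite_meeting) auto
    finally show "avg n (\<lambda>x. avg n (\<lambda>y. avg n (\<lambda>z.
          f (glue J x y) * f (glue J x z) - f (glue (J - B) x y) * f (glue (J - B) x z))))
        = (\<Sum>U | U \<subseteq> {..<n} \<and> U \<inter> B \<noteq> {}. of_bool (U \<subseteq> J) * (fourier n f U)\<^sup>2)" .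
  qed auto
  also have "\<dots> = (\<Sum>U | U \<subseteq> {..<n} \<and> U \<inter> B \<noteq> {}.
      measure_pmf.prob (subset_pmf n k) {J. U \<subseteq> J} * (fourier n f U)\<^sup>2)"
    by (simp only: expectation_sum_pmf_finite[OF fin] integral_mult_left_zero expectation_of_bool)
  also have "\<dots> = influence n f k B"
    unfolding influence_def noisy_weight_def by (intro sum.cong) (auto simp: prob_subset_pmf)
  finally show ?thesis .
qed

lemma noise_points_in_cube:
  "s \<in> set_pmf (noise_sample n k) \<Longrightarrow> set (noise_points B s) \<subseteq> cube n"
  by (auto simp: set_noise_sample noise_points_def glue_in_cube)

lemma abs_noise_stat_le:
  assumes "f \<in> boolean_functions n" "s \<in> set_pmf (noise_sample n k)"
  shows "\<bar>noise_stat f B s\<bar> \<le> 2"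
proof -
  obtain J x y z where s: "s = (J, x, y, z)" by (cases s)
  have "x \<in> cube n" "y \<in> cube n" "z \<in> cube n" using assms(2) by (auto simp: s set_noise_sample)
  then have "\<bar>f (glue J x y) * f (glue J x z)\<bar> = 1"
    "\<bar>f (glue (J - B) x y) * f (glue (J - B) x z)\<bar> = 1"
    by (simp_all add: abs_mult boolean_function_abs[OF assms(1)] glue_in_cube)
  then show ?thesis by (simp add: s noise_stat_def)
qed

text \<open>Locality: the recorded answers at the listed points may stand in for the oracle.\<close>

lemma noise_stat_cong:
  "(\<And>x. x \<in> set (noise_points B s) \<Longrightarrow> f x = g x) \<Longrightarrow> noise_stat f B s = noise_stat g B s"
  by (auto simp: noise_stat_def noise_points_def split: prod.splits)

section \<open>Estimating the L1 norm by nested sampling\<close>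

definition l1_sample :: "nat \<Rightarrow> nat \<Rightarrow> (point \<times> point list) pmf" where
  "l1_sample n L = pair_pmf (pmf_of_set (cube n)) (replicate_pmf L (pmf_of_set (cube n)))"

definition l1_stat :: "(point \<Rightarrow> real) \<Rightarrow> nat set \<Rightarrow> point \<times> point list \<Rightarrow> real" where
  "l1_stat f R = (\<lambda>(x, ys). \<bar>mean (\<lambda>y. f (glue R x y)) ys\<bar>)"

definition l1_points :: "nat set \<Rightarrow> point \<times> point list \<Rightarrow> point list" where
  "l1_points R = (\<lambda>(x, ys). map (glue R x) ys)"

lemma set_l1_sample:
  "set_pmf (l1_sample n L) = cube n \<times> {ys \<in> lists (cube n). length ys = L}"
  by (simp add: l1_sample_def set_pmf_cube set_replicate_pmf)

lemma finite_set_l1_sample: "finite (set_pmf (l1_sample n L))"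
  by (simp add: l1_sample_def set_pmf_cube finite_cube finite_set_replicate_pmf)

lemma l1_points_in_cube: "s \<in> set_pmf (l1_sample n L) \<Longrightarrow> set (l1_points R s) \<subseteq> cube n"
  by (auto simp: set_l1_sample l1_points_def glue_in_cube)

lemma length_l1_points: "s \<in> set_pmf (l1_sample n L) \<Longrightarrow> length (l1_points R s) = L"
  by (auto simp: set_l1_sample l1_points_def)

lemma mean_cong: "(\<And>x. x \<in> set xs \<Longrightarrow> F x = G x) \<Longrightarrow> mean F xs = mean G xs"
  unfolding mean_def by (metis (mono_tags, lifting) map_cong)

lemma abs_mean_le_1:
  assumes "\<And>x. x \<in> set xs \<Longrightarrow> \<bar>F x\<bar> \<le> 1"
  shows "\<bar>mean F xs\<bar> \<le> 1"
proof -
  have "\<bar>\<Sum>x\<leftarrow>xs. F x\<bar> \<le> real (length xs)"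
    using assms by (induction xs) (auto intro: order_trans[OF abs_triangle_ineq] add_mono)
  then show ?thesis by (auto simp: mean_def divide_simps)
qed

lemma l1_stat_cong:
  "(\<And>x. x \<in> set (l1_points R s) \<Longrightarrow> f x = g x) \<Longrightarrow> l1_stat f R s = l1_stat g R s"
  unfolding l1_stat_def l1_points_def
  by (auto split: prod.splits intro!: arg_cong[where f = abs] mean_cong)

lemma abs_l1_stat_le:
  assumes "f \<in> boolean_functions n" "s \<in> set_pmf (l1_sample n L)"
  shows "\<bar>l1_stat f R s\<bar> \<le> 1"
proof -
  obtain x ys where s: "s = (x, ys)" by (cases s)
  show ?thesis
    using assms(2) unfolding s l1_stat_def
    by (auto intro!: abs_mean_le_1 simp: set_l1_sample glue_in_cube boolean_function_abs[OF assms(1)])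
qed

text \<open>The absolute value of an inner empirical mean is biased; with \<open>r\<^sup>2\<close>
  inner samples its mean squared error is at most \<open>1 / r\<^sup>2\<close>, so the bias is at
  most \<open>1 / r\<close>.\<close>

lemma expectation_l1_stat:
  assumes f: "f \<in> boolean_functions n" and r: "0 < r"
  shows "\<bar>measure_pmf.expectation (l1_sample n (r\<^sup>2)) (l1_stat f R) - cond_l1 n f R\<bar> \<le> 1 / real r"
proof -
  let ?U = "pmf_of_set (cube n)" and ?L = "r\<^sup>2"
  let ?m = "\<lambda>x. mean (\<lambda>y. f (glue R x y))" and ?E = measure_pmf.expectation
  have finU: "finite (set_pmf ?U)" by (simp add: set_pmf_cube finite_cube)
  note finR = finite_set_replicate_pmf[OF finU, of ?L]
  have dev: "\<bar>?E (replicate_pmf ?L ?U) (\<lambda>ys. \<bar>?m x ys\<bar>) - \<bar>cond_avg n f R x\<bar>\<bar> \<le> 1 / real r"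
    if x: "x \<in> cube n" for x
  proof -
    let ?D = "\<lambda>ys. ?m x ys - cond_avg n f R x"
    have "?E (replicate_pmf ?L ?U) (\<lambda>ys. \<bar>?m x ys\<bar>) - \<bar>cond_avg n f R x\<bar>
        = ?E (replicate_pmf ?L ?U) (\<lambda>ys. \<bar>?m x ys\<bar> - \<bar>cond_avg n f R x\<bar>)"
      by (simp add: integrable_measure_pmf_finite finR)
    also have "\<bar>\<dots>\<bar> \<le> ?E (replicate_pmf ?L ?U) (\<lambda>ys. \<bar>\<bar>?m x ys\<bar> - \<bar>cond_avg n f R x\<bar>\<bar>)"
      by (rule integral_abs_bound)
    also have "\<dots> \<le> ?E (replicate_pmf ?L ?U) (\<lambda>ys. real r / 2 * (?D ys)\<^sup>2 + 1 / (2 * real r))"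
    proof (rule expectation_mono_pmf_finite[OF finR])
      fix ys
      \<comment> \<open>Weighted AM-GM bounds the absolute deviation by its square, balanced so that
        both terms contribute \<open>1 / (2 * r)\<close>.\<close>
      have "0 \<le> (real r * \<bar>?D ys\<bar> - 1)\<^sup>2 / (2 * real r)" using r by simp
      also have "\<dots> = real r / 2 * (?D ys)\<^sup>2 + 1 / (2 * real r) - \<bar>?D ys\<bar>"
        using r by (simp add: power2_eq_square field_simps)
      finally show "\<bar>\<bar>?m x ys\<bar> - \<bar>cond_avg n f R x\<bar>\<bar> \<le> real r / 2 * (?D ys)\<^sup>2 + 1 / (2 * real r)"
        using abs_triangle_ineq3[of "?m x ys" "cond_avg n f R x"] by linarith
    qed
    also have "\<dots> = real r / 2 * ?E (replicate_pmf ?L ?U) (\<lambda>ys. (?D ys)\<^sup>2) + 1 / (2 * real r)"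
      by (simp add: integrable_measure_pmf_finite finR)
    also have "\<dots> \<le> real r / 2 * (1\<^sup>2 / real ?L) + 1 / (2 * real r)"
    proof -
      have "?E (replicate_pmf ?L ?U) (\<lambda>ys. (?D ys)\<^sup>2) \<le> 1\<^sup>2 / real ?L"
        unfolding cond_avg_def avg_def
        by (rule replicate_pmf_mean_square[OF finU])
           (use x r in \<open>auto simp: set_pmf_cube glue_in_cube boolean_function_abs[OF f]\<close>)
      then show ?thesis by (intro add_right_mono mult_left_mono) auto
    qed
    also have "\<dots> = 1 / real r" using r by (simp add: power2_eq_square field_simps)
    finally show ?thesis .
  qed
  have "measure_pmf.expectation (l1_sample n ?L) (l1_stat f R) - cond_l1 n f R
      = avg n (\<lambda>x. ?E (replicate_pmf ?L ?U) (\<lambda>ys. \<bar>?m x ys\<bar>) - \<bar>cond_avg n f R x\<bar>)"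
    unfolding l1_sample_def cond_l1_def avg_diff
    by (simp add: expectation_pair_pmf_finite finU finR l1_stat_def avg_def)
  also have "\<bar>\<dots>\<bar> \<le> avg n (\<lambda>x. 1 / real r)"
    by (rule order_trans[OF abs_avg_le avg_mono[OF dev]])
  finally show ?thesis by simp
qed

subsection \<open>The algorithm\<close>

text \<open>\<open>g\<close> records the answers, so that the continuation \<open>C\<close> can treat it as the oracle at the points \<open>xs\<close>.\<close>

primrec ask :: "point list \<Rightarrow> (point \<Rightarrow> real) \<Rightarrow> ((point \<Rightarrow> real) \<Rightarrow> query_alg) \<Rightarrow> query_alg" where
  "ask [] g C = C g"
| "ask (x # xs) g C = Query x (\<lambda>v. ask xs (g(x := v)) C)"

lemma override_on_insert_fst: "override_on (g(x := f x)) f A = override_on g f (insert x A)"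
  by (auto simp: override_on_def fun_eq_iff)

lemma run_ask: "run f (ask xs g C) = run f (C (override_on g f (set xs)))"
  by (induction xs arbitrary: g) (simp_all add: override_on_insert_fst)

lemma queries_ask: "queries f (ask xs g C) = xs @ queries f (C (override_on g f (set xs)))"
  by (induction xs arbitrary: g) (simp_all add: override_on_insert_fst)

text \<open>The cutoff \<open>3 / 2\<close> leaves room for an estimation error of
  \<open>1 / 4\<close> above the \<open>5 / 4\<close> of \<open>good_hash_upper\<close> and below
  the \<open>9 / 4\<close> of \<open>hash_lower\<close>.\<close>

definition select ::
  "nat \<Rightarrow> nat \<Rightarrow> real \<Rightarrow> nat \<Rightarrow> (nat \<Rightarrow> nat) \<Rightarrow> (nat set \<times> point \<times> point \<times> point) list
    \<Rightarrow> (point \<Rightarrow> real) \<Rightarrow> nat set" where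
  "select n k \<epsilon> M h s f = hash_preimage n h {b \<in> {..<M}.
     3 / 2 * (noise k ^ k * \<epsilon>\<^sup>2) \<le> real k * mean (noise_stat f (hash_preimage n h {b})) s}"

text \<open>Two rounds of queries: the points of the first are fixed by the coins, those of the
  second depend on \<open>R\<close>. The samples \<open>s\<close> serve all buckets. The shift by
  \<open>3 / 4 * \<epsilon>\<close> balances the errors, since the value at \<open>R\<close> may be
  low by \<open>3 / 2 * \<epsilon>\<close> but high by only \<open>\<epsilon> / 8\<close>.\<close>

definition junta_alg ::
  "nat \<Rightarrow> nat \<Rightarrow> real \<Rightarrow> nat \<Rightarrow> (nat \<Rightarrow> nat) \<Rightarrow> (nat set \<times> point \<times> point \<times> point) list
    \<Rightarrow> (point \<times> point list) list \<Rightarrow> query_alg" where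
  "junta_alg n k \<epsilon> M h s t =
     ask (concat (map (\<lambda>b. concat (map (noise_points (hash_preimage n h {b})) s)) [0..<M])) (\<lambda>_. 0)
       (\<lambda>f. let R = select n k \<epsilon> M h s f in
         ask (concat (map (l1_points R) t)) (\<lambda>_. 0)
           (\<lambda>f. Output (mean (l1_stat f R) t + 3 / 4 * \<epsilon>)))"

text \<open>The statistics look only at points that were asked, so the default answers elsewhere
  never matter.\<close>

lemma select_override:
  "select n k \<epsilon> M h s (override_on g f
     (set (concat (map (\<lambda>b. concat (map (noise_points (hash_preimage n h {b})) s)) [0..<M]))))
   = select n k \<epsilon> M h s f"
proof -
  let ?A = "set (concat (map (\<lambda>b. concat (map (noise_points (hash_preimage n h {b})) s)) [0..<M]))"
  have "mean (noise_stat (override_on g f ?A) (hash_preimage n h {b})) s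
      = mean (noise_stat f (hash_preimage n h {b})) s" if "b < M" for b
  proof (intro mean_cong noise_stat_cong)
    fix \<sigma> x assume "\<sigma> \<in> set s" "x \<in> set (noise_points (hash_preimage n h {b}) \<sigma>)"
    then have "x \<in> ?A" using that by force
    then show "override_on g f ?A x = f x" by (rule override_on_apply_in)
  qed
  then show ?thesis unfolding select_def by (intro arg_cong[where f = "hash_preimage n h"]) auto
qed

lemma run_junta_alg:
  "run f (junta_alg n k \<epsilon> M h s t) = mean (l1_stat f (select n k \<epsilon> M h s f)) t + 3 / 4 * \<epsilon>"
proof -
  let ?R = "select n k \<epsilon> M h s f"
  let ?A = "set (concat (map (l1_points ?R) t))"
  have "mean (l1_stat (override_on (\<lambda>_. 0) f ?A) ?R) t = mean (l1_stat f ?R) t"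
    by (intro mean_cong l1_stat_cong override_on_apply_in) auto
  then show ?thesis
    unfolding junta_alg_def run_ask select_override by (simp add: Let_def run_ask)
qed

lemma queries_junta_alg:
  "queries f (junta_alg n k \<epsilon> M h s t)
     = concat (map (\<lambda>b. concat (map (noise_points (hash_preimage n h {b})) s)) [0..<M])
       @ concat (map (l1_points (select n k \<epsilon> M h s f)) t)"
  unfolding junta_alg_def queries_ask select_override by (simp add: Let_def queries_ask)

lemma length_concat_map_const:
  "(\<And>x. x \<in> set xs \<Longrightarrow> length (F x) = c) \<Longrightarrow> length (concat (map F xs)) = length xs * c"
  by (induction xs) auto

lemma queries_junta_alg_bounds:
  assumes s: "s \<in> set_pmf (replicate_pmf N (noise_sample n k))"
    and t: "t \<in> set_pmf (replicate_pmf N' (l1_sample n L))"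
  shows "set (queries f (junta_alg n k \<epsilon> M h s t)) \<subseteq> cube n"
    and "length (queries f (junta_alg n k \<epsilon> M h s t)) = M * (N * 4) + N' * L"
proof -
  have s': "length s = N" "\<And>\<sigma>. \<sigma> \<in> set s \<Longrightarrow> \<sigma> \<in> set_pmf (noise_sample n k)"
    and t': "length t = N'" "\<And>\<tau>. \<tau> \<in> set t \<Longrightarrow> \<tau> \<in> set_pmf (l1_sample n L)"
    using s t by (auto simp: set_replicate_pmf)
  show "set (queries f (junta_alg n k \<epsilon> M h s t)) \<subseteq> cube n"
    unfolding queries_junta_alg
    using noise_points_in_cube[OF s'(2)] l1_points_in_cube[OF t'(2)] by fastforce
  have "length (concat (map (noise_points B) s)) = N * 4" for B
    using s'(1) by (subst length_concat_map_const) (auto simp: noise_points_def split: prod.splits)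
  moreover have "length (concat (map (l1_points R) t)) = N' * L" for R
    using t'(1) length_l1_points[OF t'(2)] by (subst length_concat_map_const) auto
  ultimately show "length (queries f (junta_alg n k \<epsilon> M h s t)) = M * (N * 4) + N' * L"
    unfolding queries_junta_alg by (subst length_append, subst length_concat_map_const) auto
qed

subsection \<open>Correctness\<close>

text \<open>After multiplication by \<open>k\<close> the error is at most a quarter of
  \<open>noise k ^ k * \<epsilon>\<^sup>2\<close>; \<open>k + 1\<close> avoids dividing by
  zero.\<close>

definition accurate_influences ::
  "nat \<Rightarrow> (point \<Rightarrow> real) \<Rightarrow> nat \<Rightarrow> real \<Rightarrow> nat \<Rightarrow> (nat \<Rightarrow> nat)
    \<Rightarrow> (nat set \<times> point \<times> point \<times> point) list \<Rightarrow> bool" where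
  "accurate_influences n f k \<epsilon> M h s \<longleftrightarrow> (\<forall>b<M.
     \<bar>mean (noise_stat f (hash_preimage n h {b})) s - influence n f k (hash_preimage n h {b})\<bar>
       < noise k ^ k * \<epsilon>\<^sup>2 / (4 * (real k + 1)))"

lemma select_correct:
  assumes f: "f \<in> boolean_functions n" and \<epsilon>: "0 < \<epsilon>" and good: "good_hash n f k \<epsilon> h"
    and h: "\<And>i. i < n \<Longrightarrow> h i < M" and acc: "accurate_influences n f k \<epsilon> M h s"
  shows "max_junta_correlation n (real k) f \<le> cond_l1 n f (select n k \<epsilon> M h s f) + 3 / 2 * \<epsilon>"
    and "cond_l1 n f (select n k \<epsilon> M h s f)
      \<le> max_junta_correlation n ((real k)\<^sup>2 / \<epsilon>\<^sup>2) f + \<epsilon> / 8"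
proof -
  let ?I = "\<lambda>b. influence n f k (hash_preimage n h {b})"
  let ?m = "\<lambda>b. mean (noise_stat f (hash_preimage n h {b})) s"
  let ?u = "noise k ^ k * \<epsilon>\<^sup>2"
  have u: "0 < ?u" using noise_power_pos[of k] \<epsilon> by simp
  have close: "\<bar>real k * ?m b - real k * ?I b\<bar> \<le> ?u / 4" if "b < M" for b
  proof -
    have "\<bar>real k * ?m b - real k * ?I b\<bar> = real k * \<bar>?m b - ?I b\<bar>"
      by (simp add: abs_mult flip: right_diff_distrib)
    also have "\<dots> \<le> (real k + 1) * (?u / (4 * (real k + 1)))"
      using acc that by (intro mult_mono) (auto simp: accurate_influences_def intro: less_imp_le)
    also have "\<dots> = ?u / 4" by (simp add: divide_simps)
    finally show ?thesis .
  qed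
  show "max_junta_correlation n (real k) f \<le> cond_l1 n f (select n k \<epsilon> M h s f) + 3 / 2 * \<epsilon>"
    unfolding select_def
  proof (rule hash_lower[OF \<epsilon>])
    fix i assume "i < n" "h i \<notin> {b \<in> {..<M}. 3 / 2 * ?u \<le> real k * ?m b}"
    then have "real k * ?m (h i) < 3 / 2 * ?u" "h i < M" using h by auto
    \<comment> \<open>\<open>3 / 2 + 1 / 4\<close> stays below \<open>9 / 4\<close>.\<close>
    then show "real k * ?I (h i) \<le> 9 / 4 * ?u" using close[of "h i"] u by linarith
  qed
  show "cond_l1 n f (select n k \<epsilon> M h s f)
      \<le> max_junta_correlation n ((real k)\<^sup>2 / \<epsilon>\<^sup>2) f + \<epsilon> / 8"
    unfolding select_def
  proof (rule good_hash_upper[OF f \<epsilon> good])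
    fix b assume "b \<in> {b \<in> {..<M}. 3 / 2 * ?u \<le> real k * ?m b}"
    then have "3 / 2 * ?u \<le> real k * ?m b" "b < M" by auto
    then show "5 / 4 * ?u \<le> real k * ?I b" using close[of b] by linarith
  qed
qed

lemma prob_not_accurate_influences:
  assumes f: "f \<in> boolean_functions n" and \<epsilon>: "0 < \<epsilon>"
    and N: "0 < N" "5184 * real M * (real k + 1)\<^sup>2 \<le> real N * \<epsilon> ^ 4"
  shows "measure_pmf.prob (replicate_pmf N (noise_sample n k))
    {s. \<not> accurate_influences n f k \<epsilon> M h s} \<le> 1 / 9"
proof -
  let ?p = "replicate_pmf N (noise_sample n k)" and ?B = "\<lambda>b. hash_preimage n h {b}"
  define t where "t = noise k ^ k * \<epsilon>\<^sup>2 / (4 * (real k + 1))"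
  have t: "0 < t" using noise_power_pos[of k] \<epsilon> by (simp add: t_def)
  let ?bad = "\<lambda>b. {s. t \<le> \<bar>mean (noise_stat f (?B b)) s - influence n f k (?B b)\<bar>}"
  have "measure_pmf.prob ?p {s. \<not> accurate_influences n f k \<epsilon> M h s}
      = measure_pmf.prob ?p (\<Union>b<M. ?bad b)"
    unfolding accurate_influences_def t_def[symmetric]
    by (intro arg_cong[where f = "measure_pmf.prob ?p"]) (auto simp: not_less)
  also have "\<dots> \<le> (\<Sum>b<M. measure_pmf.prob ?p (?bad b))"
    by (intro measure_pmf.finite_measure_subadditive_finite) auto
  also have "\<dots> \<le> (\<Sum>b<M. 2\<^sup>2 / (real N * t\<^sup>2))"
    unfolding expectation_noise_stat[of n k f, symmetric]
    by (intro sum_mono replicate_pmf_mean_tail finite_set_noise_sample abs_noise_stat_le[OF f] N t)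
  also have "\<dots> = 4 * real M / (real N * t\<^sup>2)" by simp
  also have "\<dots> \<le> 1 / 9"
  proof -
    \<comment> \<open>\<open>5184 = 36 * 16 * 9\<close>: 36 from the Chebyshev bound and the target
      \<open>1 / 9\<close>, 16 from the denominator of \<open>t\<close>, and 9 from
      \<open>noise_power_ge\<close> squared.\<close>
    have "36 * real M * (16 * (real k + 1)\<^sup>2) \<le> real N * \<epsilon> ^ 4 * (1 / 3)\<^sup>2"
      using N(2) by (simp add: power2_eq_square)
    also have "\<dots> \<le> real N * \<epsilon> ^ 4 * (noise k ^ k)\<^sup>2"
      using noise_power_ge[of k] \<epsilon> by (intro mult_left_mono power_mono) auto
    also have "\<dots> = real N * t\<^sup>2 * (16 * (real k + 1)\<^sup>2)"
    proof -
      have "noise k ^ k * \<epsilon>\<^sup>2 = t * (4 * (real k + 1))"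
      proof -
        have "0 < 4 * (real k + 1)" by (intro mult_pos_pos) auto
        then have "4 * (real k + 1) \<noteq> 0" by (rule less_imp_neq[symmetric])
        then show ?thesis
          unfolding t_def times_divide_eq_left by (rule nonzero_mult_div_cancel_right[symmetric])
      qed
      then have "(noise k ^ k * \<epsilon>\<^sup>2)\<^sup>2 = t\<^sup>2 * (16 * (real k + 1)\<^sup>2)"
        by (simp only: power_mult_distrib) simp
      moreover have "real N * \<epsilon> ^ 4 * (noise k ^ k)\<^sup>2 = real N * (noise k ^ k * \<epsilon>\<^sup>2)\<^sup>2"
        by (simp add: power_mult_distrib flip: power_mult)
      ultimately show ?thesis by (simp only: mult.assoc)
    qed
    finally have "36 * real M \<le> real N * t\<^sup>2" by simp
    then show ?thesis using t N(1) by (simp add: divide_simps)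
  qed
  finally show ?thesis .
qed

definition rand_junta_alg :: "nat \<Rightarrow> nat \<Rightarrow> real \<Rightarrow> nat \<Rightarrow> nat \<Rightarrow> nat \<Rightarrow> nat \<Rightarrow> rand_query_alg" where
  "rand_junta_alg n k \<epsilon> M N N' L =
     hash_pmf n M \<bind> (\<lambda>h. replicate_pmf N (noise_sample n k) \<bind> (\<lambda>s.
       map_pmf (junta_alg n k \<epsilon> M h s) (replicate_pmf N' (l1_sample n L))))"

lemma rand_junta_alg_correct:
  assumes f: "f \<in> boolean_functions n" and \<epsilon>: "0 < \<epsilon>" and q: "0 < q" "1 \<le> real q * \<epsilon>"
    and M: "0 < M" "1000 * (real k + 1) ^ 4 \<le> real M * \<epsilon> ^ 4"
    and N: "0 < N" "5184 * real M * (real k + 1)\<^sup>2 \<le> real N * \<epsilon> ^ 4"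
  shows "2 / 3 \<le> measure_pmf.prob (rand_junta_alg n k \<epsilon> M N (2304 * q\<^sup>2) ((16 * q)\<^sup>2))
         {t. max_junta_correlation n (real k) f - \<epsilon> \<le> run f t \<and>
             run f t \<le> max_junta_correlation n ((real k)\<^sup>2 / \<epsilon>\<^sup>2) f + \<epsilon>}"
    (is "_ \<le> measure_pmf.prob ?A ?good")
proof -
  let ?N' = "2304 * q\<^sup>2" and ?L = "(16 * q)\<^sup>2"
  have tail: "measure_pmf.prob (map_pmf (junta_alg n k \<epsilon> M h s)
        (replicate_pmf ?N' (l1_sample n ?L))) (- ?good) \<le> 1 / 9"
    if h: "h \<in> set_pmf (hash_pmf n M)" "good_hash n f k \<epsilon> h"
      and s: "accurate_influences n f k \<epsilon> M h s" for h s
  proof -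
    let ?R = "select n k \<epsilon> M h s f"
    let ?E = "measure_pmf.expectation (l1_sample n ?L) (l1_stat f ?R)"
    note R = select_correct[OF f \<epsilon> h(2) set_hash_pmf(2)[OF M(1) h(1)] s]
    have "\<bar>?E - cond_l1 n f ?R\<bar> \<le> 1 / real (16 * q)"
      using q by (intro expectation_l1_stat[OF f]) simp
    also have "\<dots> \<le> \<epsilon> / 16" using q by (simp add: field_simps)
    finally have E: "\<bar>?E - cond_l1 n f ?R\<bar> \<le> \<epsilon> / 16" .
    have "measure_pmf.prob (map_pmf (junta_alg n k \<epsilon> M h s) (replicate_pmf ?N' (l1_sample n ?L))) (- ?good)
        \<le> measure_pmf.prob (replicate_pmf ?N' (l1_sample n ?L)) {t. \<epsilon> / 16 \<le> \<bar>mean (l1_stat f ?R) t - ?E\<bar>}"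
      unfolding measure_map_pmf
    proof (intro measure_pmf.finite_measure_mono subsetI CollectI)
      fix t assume "t \<in> junta_alg n k \<epsilon> M h s -` (- ?good)"
      then consider "run f (junta_alg n k \<epsilon> M h s t) < max_junta_correlation n (real k) f - \<epsilon>"
        | "max_junta_correlation n ((real k)\<^sup>2 / \<epsilon>\<^sup>2) f + \<epsilon> < run f (junta_alg n k \<epsilon> M h s t)"
        by fastforce
      \<comment> \<open>With bias and sampling error below \<open>\<epsilon> / 16\<close> each, the
        output would be low by at most \<open>3 / 2 - 3 / 4 + 1 / 8 = 7 / 8\<close> and high by at
        most \<open>1 / 8 + 3 / 4 + 1 / 8 = 1\<close>, in units of
        \<open>\<epsilon>\<close>.\<close>
      then show "\<epsilon> / 16 \<le> \<bar>mean (l1_stat f ?R) t - ?E\<bar>"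
        using R E \<epsilon> unfolding run_junta_alg by cases linarith+
    qed simp
    \<comment> \<open>\<open>2304 = 9 * 16\<^sup>2\<close> makes this at most
      \<open>1 / 9\<close>.\<close>
    also have "\<dots> \<le> 1\<^sup>2 / (real ?N' * (\<epsilon> / 16)\<^sup>2)"
      using q \<epsilon> by (intro replicate_pmf_mean_tail finite_set_l1_sample abs_l1_stat_le[OF f]) auto
    also have "\<dots> = 1 / (9 * (real q * \<epsilon>)\<^sup>2)"
      by (simp add: power2_eq_square field_simps)
    also have "\<dots> \<le> 1 / 9"
      using q power_mono[of 1 "real q * \<epsilon>" 2] by (simp add: divide_simps)
    finally show ?thesis .
  qed
  \<comment> \<open>One ninth each for the hash, the influence estimates and the final L1
    estimate.\<close>
  have "measure_pmf.prob ?A (- ?good) \<le> 1 / 9 + (1 / 9 + 1 / 9)"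
    unfolding rand_junta_alg_def
  proof (rule prob_bind_pmf_le[OF set_hash_pmf(1)[OF M(1)] prob_not_good_hash[OF f \<epsilon> M]])
    fix h assume h: "h \<in> set_pmf (hash_pmf n M)" "good_hash n f k \<epsilon> h"
    show "measure_pmf.prob (replicate_pmf N (noise_sample n k) \<bind> (\<lambda>s.
        map_pmf (junta_alg n k \<epsilon> M h s) (replicate_pmf ?N' (l1_sample n ?L)))) (- ?good)
      \<le> 1 / 9 + 1 / 9"
      by (rule prob_bind_pmf_le[OF finite_set_replicate_pmf[OF finite_set_noise_sample]
            prob_not_accurate_influences[OF f \<epsilon> N, of h] tail[OF h]]) simp_all
  qed simp
  then show ?thesis
    using measure_pmf.prob_compl[of ?good ?A] by (simp add: Compl_eq_Diff_UNIV)
qed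

lemma queries_rand_junta_alg:
  assumes "t \<in> set_pmf (rand_junta_alg n k \<epsilon> M N N' L)"
  shows "set (queries f t) \<subseteq> cube n" and "length (queries f t) = M * (N * 4) + N' * L"
proof -
  obtain h s u where *: "s \<in> set_pmf (replicate_pmf N (noise_sample n k))"
      "u \<in> set_pmf (replicate_pmf N' (l1_sample n L))" "t = junta_alg n k \<epsilon> M h s u"
    using assms unfolding rand_junta_alg_def by auto
  show "set (queries f t) \<subseteq> cube n" "length (queries f t) = M * (N * 4) + N' * L"
    unfolding *(3) by (rule queries_junta_alg_bounds[OF *(1,2)])+
qed

theorem theorem1p5:
  "\<exists>(A :: nat \<Rightarrow> nat \<Rightarrow> real \<Rightarrow> rand_query_alg) (d :: nat) (c :: nat \<Rightarrow> nat \<Rightarrow> real).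
     \<forall>(n :: nat) (k :: nat) (\<epsilon> :: real). \<forall>f \<in> boolean_functions n. \<epsilon> > 0 \<longrightarrow>
       (\<forall>t \<in> set_pmf (A n k \<epsilon>).
          set (queries f t) \<subseteq> cube n \<and>
          real (length (queries f t)) \<le> (\<Sum>i\<le>d. \<Sum>j\<le>d. c i j * real k ^ i * (1 / \<epsilon>) ^ j)) \<and>
       measure_pmf.prob (A n k \<epsilon>)
         {t. max_junta_correlation n (real k) f - \<epsilon> \<le> run f t \<and>
             run f t \<le> max_junta_correlation n ((real k)\<^sup>2 / \<epsilon>\<^sup>2) f + \<epsilon>} \<ge> 2 / 3"
proof -
  define q where "q \<epsilon> = nat \<lceil>1 / \<epsilon>\<rceil>" for \<epsilon> :: real
  define M where "M k \<epsilon> = 1000 * (k + 1) ^ 4 * q \<epsilon> ^ 4" for k \<epsilon>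
  define N where "N k \<epsilon> = 5184 * M k \<epsilon> * (k + 1)\<^sup>2 * q \<epsilon> ^ 4" for k \<epsilon>
  \<comment> \<open>For \<open>\<epsilon>\<close> at least 1 the answer 0 is always valid and needs
    no query, so a bound vanishing for large \<open>\<epsilon>\<close> is harmless.\<close>
  define A where "A n k \<epsilon> = (if 1 \<le> \<epsilon> then return_pmf (Output 0) else
    rand_junta_alg n k \<epsilon> (M k \<epsilon>) (N k \<epsilon>) (2304 * (q \<epsilon>)\<^sup>2) ((16 * q \<epsilon>)\<^sup>2))" for n k \<epsilon>
  \<comment> \<open>The coefficients of
    \<open>10 ^ 14 * (k + 1) ^ 12 * (1 / \<epsilon>) ^ 12\<close> by the binomial theorem.\<close>
  define c where "c i j = (if j = 12 then 10 ^ 14 * real (12 choose i) else 0)" for i j :: nat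
  have bound: "(\<Sum>i\<le>12. \<Sum>j\<le>12. c i j * real k ^ i * (1 / \<epsilon>) ^ j)
      = 10 ^ 14 * (real k + 1) ^ 12 * (1 / \<epsilon>) ^ 12" for k \<epsilon>
  proof -
    have "(\<Sum>j\<le>12. c i j * real k ^ i * (1 / \<epsilon>) ^ j)
        = 10 ^ 14 * (1 / \<epsilon>) ^ 12 * (real (12 choose i) * real k ^ i)" for i
    proof -
      have "(\<Sum>j\<le>12. c i j * real k ^ i * (1 / \<epsilon>) ^ j)
          = (\<Sum>j\<in>{12}. c i j * real k ^ i * (1 / \<epsilon>) ^ j)"
        by (rule sum.mono_neutral_right) (auto simp: c_def)
      then show ?thesis by (simp add: c_def)
    qed
    then show ?thesis
      by (simp add: sum_distrib_left[symmetric] binomial_ring[of "real k" 1])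
  qed
  have "(\<forall>t \<in> set_pmf (A n k \<epsilon>). set (queries f t) \<subseteq> cube n \<and>
          real (length (queries f t)) \<le> (\<Sum>i\<le>12. \<Sum>j\<le>12. c i j * real k ^ i * (1 / \<epsilon>) ^ j)) \<and>
       measure_pmf.prob (A n k \<epsilon>)
         {t. max_junta_correlation n (real k) f - \<epsilon> \<le> run f t \<and>
             run f t \<le> max_junta_correlation n ((real k)\<^sup>2 / \<epsilon>\<^sup>2) f + \<epsilon>} \<ge> 2 / 3"
    if f: "f \<in> boolean_functions n" and \<epsilon>: "\<epsilon> > 0" for n k \<epsilon> f
  proof (cases "1 \<le> \<epsilon>")
    case True
    obtain J where "max_junta_correlation n (real k) f \<le> cond_l1 n f J"
      by (rule max_junta_correlation_le_cond_l1[of "real k"]) auto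
    then have "max_junta_correlation n (real k) f \<le> 1"
      using cond_l1_le_1[OF f, of J] by linarith
    moreover have "0 \<le> max_junta_correlation n ((real k)\<^sup>2 / \<epsilon>\<^sup>2) f"
    proof -
      have "0 \<le> cond_l1 n f {}"
        using avg_mono[of n "\<lambda>_. 0"] by (simp add: cond_l1_def)
      also have "\<dots> \<le> max_junta_correlation n ((real k)\<^sup>2 / \<epsilon>\<^sup>2) f"
        by (rule cond_l1_le_max_junta_correlation) auto
      finally show ?thesis .
    qed
    ultimately show ?thesis
      unfolding bound using True \<epsilon> by (simp add: A_def)
  next
    case False
    let ?q = "real (q \<epsilon>)" and ?K = "real k + 1"
    have "1 < 1 / \<epsilon>" using False \<epsilon> by simp
    \<comment> \<open>Rounding up adds less than 1, which is below \<open>1 / \<epsilon>\<close>;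
      hence the factor 2.\<close>
    then have q: "0 < q \<epsilon>" "1 / \<epsilon> \<le> ?q" "?q \<le> 2 * (1 / \<epsilon>)"
      unfolding q_def by linarith+
    then have q\<epsilon>: "1 \<le> ?q * \<epsilon>" using \<epsilon> by (simp add: field_simps)
    then have q\<epsilon>4: "1 \<le> ?q ^ 4 * \<epsilon> ^ 4"
      using one_le_power[of "?q * \<epsilon>" 4] by (simp add: power_mult_distrib)
    have M: "0 < M k \<epsilon>" "1000 * ?K ^ 4 \<le> real (M k \<epsilon>) * \<epsilon> ^ 4"
      using q(1) mult_left_mono[OF q\<epsilon>4, of "1000 * ?K ^ 4"]
      by (simp_all add: M_def algebra_simps)
    have N: "0 < N k \<epsilon>" "5184 * real (M k \<epsilon>) * ?K\<^sup>2 \<le> real (N k \<epsilon>) * \<epsilon> ^ 4"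
      using q(1) M(1) mult_left_mono[OF q\<epsilon>4, of "5184 * real (M k \<epsilon>) * ?K\<^sup>2"]
      by (simp_all add: N_def algebra_simps)
    have len: "real (M k \<epsilon> * (N k \<epsilon> * 4) + 2304 * (q \<epsilon>)\<^sup>2 * (16 * q \<epsilon>)\<^sup>2)
        \<le> 10 ^ 14 * ?K ^ 12 * (1 / \<epsilon>) ^ 12"
    proof -
      define a b where "a = ?K ^ 12" and "b = ?q ^ 12"
      have ab: "0 \<le> a * b" by (simp add: a_def b_def)
      have "?K ^ 10 \<le> a" "1 \<le> a" "?q ^ 4 \<le> b"
        unfolding a_def b_def using q(1) by (intro power_increasing one_le_power; simp)+
      then have le: "?K ^ 10 * b \<le> a * b" "1 * ?q ^ 4 \<le> a * b"
        by (intro mult_mono; simp add: b_def)+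
      have MN: "real (M k \<epsilon>) = 1000 * (?K ^ 4 * ?q ^ 4)"
        "real (N k \<epsilon>) = 5184000 * ((?K ^ 4 * ?q ^ 4) * (?K\<^sup>2 * ?q ^ 4))"
        by (simp_all add: M_def N_def add.commute[of 1])
      have powers: "?K ^ 10 = ?K ^ 4 * ?K ^ 4 * ?K\<^sup>2" "b = ?q ^ 4 * ?q ^ 4 * ?q ^ 4"
        by (simp_all add: b_def flip: power_add)
      have "1000 * (x * y) * (5184000 * ((x * y) * (z * y)) * 4)
          = 20736000000 * ((x * x * z) * (y * y * y))" for x y z :: real
        by simp
      then have "real (M k \<epsilon> * (N k \<epsilon> * 4)) = 20736000000 * (?K ^ 10 * b)"
        unfolding powers of_nat_mult MN of_nat_numeral .
      moreover have "real (2304 * (q \<epsilon>)\<^sup>2 * (16 * q \<epsilon>)\<^sup>2) = 589824 * (1 * ?q ^ (2 + 2))"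
        unfolding power_add by (simp add: power_mult_distrib)
      ultimately have "real (M k \<epsilon> * (N k \<epsilon> * 4) + 2304 * (q \<epsilon>)\<^sup>2 * (16 * q \<epsilon>)\<^sup>2)
          \<le> 20736000000 * (a * b) + 589824 * (a * b)"
        unfolding of_nat_add using le by (simp del: of_nat_mult)
      also have "\<dots> \<le> 24000000000 * (a * b)"
        using ab by linarith
      also have "\<dots> \<le> 24000000000 * (a * (2 * (1 / \<epsilon>)) ^ 12)"
        unfolding b_def using q by (intro mult_left_mono power_mono) (auto simp: a_def)
      also have "\<dots> = 24000000000 * 2 ^ 12 * (a * (1 / \<epsilon>) ^ 12)"
        unfolding power_mult_distrib by (simp only: mult_ac)
      \<comment> \<open>\<open>24000000000 * 2 ^ 12\<close> is about
        \<open>9.83 * 10 ^ 13\<close>.\<close>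
      also have "\<dots> \<le> 10 ^ 14 * (a * (1 / \<epsilon>) ^ 12)"
        using \<epsilon> by (intro mult_right_mono) (auto simp: a_def)
      also have "\<dots> = 10 ^ 14 * ?K ^ 12 * (1 / \<epsilon>) ^ 12"
        by (simp only: a_def mult.assoc)
      finally show ?thesis .
    qed
    show ?thesis
      using False queries_rand_junta_alg[where n = n and k = k and \<epsilon> = \<epsilon>] len
        rand_junta_alg_correct[OF f \<epsilon> q(1) q\<epsilon> M N]
      unfolding bound A_def by (auto simp del: of_nat_add of_nat_mult)
  qed
  then show ?thesis
    by (intro exI[of _ A] exI[of _ "12::nat"] exI[of _ c]) blast
qed

end
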